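(* Let $d,k\geq2$. If $H\leq\mathrm{AAut}(\mathcal{T}_{d,k})$ is locally elliptic, commensurated in $\mathrm{AAut}(\mathcal{T}_{d,k})$, and $\mathrm{Aut}(\mathcal{T}_{d,k})\leq H$, then $H$ is compact.
   Context: $\mathcal{T}_{d,k}$ is the rooted tree whose root $r$ has degree $k$ and all other vertices have degree $d+1$. Its boundary $\partial\mathcal{T}_{d,k}$ is the set of rays $(r=\xi_0,\xi_1,\dots)$ with $\xi_{n+1}$ a child of $\xi_n$; with $N(\xi,\xi')$ the largest $n$ such that $\xi_n=\xi'_n$, put $\mathrm{dist}(\xi,\xi')=d^{-N(\xi,\xi')}$. A homothety is a map multiplying all distances by a fixed positive constant. An almost automorphism is a homeomorphism $g$ of $\partial\mathcal{T}_{d,k}$ for which there is a partition of $\partial\mathcal{T}_{d,k}$ into finitely many proper balls $B_1,\dots,B_n$ with each $g|_{B_i}:B_i\to g(B_i)$ a homothety. $\mathrm{AAut}(\mathcal{T}_{d,k})$ is the group of almost automorphisms with the locally compact group topology in which $\mathrm{Aut}(\mathcal{T}_{d,k})$ (automorphisms of the rooted tree, i.e. isometries of $\partial\mathcal{T}_{d,k}$) is a compact open subgroup. A subgroup is locally elliptic if the closed subgroup generated by any finite subset of it is compact. A subgroup $H\leq G$ is commensurated if $gHg^{-1}\cap H$ has finite index in both $H$ and $gHg^{-1}$ for every $g\in G$. *)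

theory Defs
  imports "HOL-Analysis.Analysis" "HOL-Algebra.Generated_Groups" "HOL-Algebra.Coset"
begin

type_synonym ray = "nat \<Rightarrow> nat"
type_synonym amap = "ray \<Rightarrow> ray"

text \<open>A ray (r = xi_0, xi_1, ...) of T_{d,k} is encoded by its sequence of child choices:
  xi_{n+1} is child number (x n) of xi_n; the root has k children, other vertices d children.\<close>
definition bdry :: "nat \<Rightarrow> nat \<Rightarrow> ray set" where
  "bdry d k = {x. x 0 < k \<and> (\<forall>i>0. x i < d)}"

text \<open>N(x,y) = number of initial agreeing choices = largest n with x_n = y_n (as vertices);
  dist = d^(-N), and 0 on the diagonal.\<close>
definition tdist :: "nat \<Rightarrow> ray \<Rightarrow> ray \<Rightarrow> real" where
  "tdist d x y = (if x = y then 0 else inverse (real d) ^ (LEAST i. x i \<noteq> y i))"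

definition proper_ball :: "nat \<Rightarrow> nat \<Rightarrow> ray set \<Rightarrow> bool" where
  "proper_ball d k B \<longleftrightarrow>
     (\<exists>x\<in>bdry d k. \<exists>r>0. B = {y\<in>bdry d k. tdist d x y < r}) \<and> B \<noteq> bdry d k"

definition homothety_on :: "nat \<Rightarrow> ray set \<Rightarrow> amap \<Rightarrow> bool" where
  "homothety_on d B g \<longleftrightarrow> (\<exists>c>0. \<forall>x\<in>B. \<forall>y\<in>B. tdist d (g x) (g y) = c * tdist d x y)"

definition continuous_bdry :: "nat \<Rightarrow> nat \<Rightarrow> amap \<Rightarrow> bool" where
  "continuous_bdry d k g \<longleftrightarrow>
     (\<forall>x\<in>bdry d k. \<forall>e>0. \<exists>\<delta>>0. \<forall>y\<in>bdry d k. tdist d x y < \<delta> \<longrightarrow> tdist d (g x) (g y) < e)"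

text \<open>Homeomorphisms of the boundary, extended by the identity outside the boundary
  (so that they form a group under composition with unit id).\<close>
definition homeo_bdry :: "nat \<Rightarrow> nat \<Rightarrow> amap \<Rightarrow> bool" where
  "homeo_bdry d k g \<longleftrightarrow> bij_betw g (bdry d k) (bdry d k) \<and> (\<forall>x. x \<notin> bdry d k \<longrightarrow> g x = x)
     \<and> continuous_bdry d k g \<and> continuous_bdry d k (inv_into (bdry d k) g)"

definition AAut :: "nat \<Rightarrow> nat \<Rightarrow> amap set" where
  "AAut d k = {g. homeo_bdry d k g \<and>
     (\<exists>P. finite P \<and> (\<forall>B\<in>P. proper_ball d k B) \<and> \<Union>P = bdry d k
        \<and> (\<forall>A\<in>P. \<forall>B\<in>P. A \<noteq> B \<longrightarrow> A \<inter> B = {})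
        \<and> (\<forall>B\<in>P. homothety_on d B g))}"

text \<open>Automorphisms of the rooted tree = isometries of the boundary.\<close>
definition Aut :: "nat \<Rightarrow> nat \<Rightarrow> amap set" where
  "Aut d k = {g. bij_betw g (bdry d k) (bdry d k) \<and> (\<forall>x. x \<notin> bdry d k \<longrightarrow> g x = x)
     \<and> (\<forall>x\<in>bdry d k. \<forall>y\<in>bdry d k. tdist d (g x) (g y) = tdist d x y)}"

definition AAutG :: "nat \<Rightarrow> nat \<Rightarrow> amap monoid" where
  "AAutG d k = \<lparr>carrier = AAut d k, monoid.mult = (\<circ>), one = id\<rparr>"

text \<open>Level-n stabilisers in Aut: the standard neighbourhood basis of the identity in Aut.\<close>
definition level_stab :: "nat \<Rightarrow> nat \<Rightarrow> nat \<Rightarrow> amap set" where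
  "level_stab d k n = {a\<in>Aut d k. \<forall>x\<in>bdry d k. \<forall>i<n. a x i = x i}"

text \<open>The group topology on AAut in which Aut (with its usual topology) is an open subgroup:
  generated by the left translates g U_n of the level stabilisers.\<close>
definition AAut_top :: "nat \<Rightarrow> nat \<Rightarrow> amap topology" where
  "AAut_top d k = topology_generated_by
     {(\<lambda>u. g \<circ> u) ` level_stab d k n | g n. g \<in> AAut d k}"

definition finite_index :: "('a, 'b) monoid_scheme \<Rightarrow> 'a set \<Rightarrow> 'a set \<Rightarrow> bool" where
  "finite_index G K H \<longleftrightarrow> finite ((\<lambda>h. K #>\<^bsub>G\<^esub> h) ` H)"

definition conj_set :: "('a, 'b) monoid_scheme \<Rightarrow> 'a \<Rightarrow> 'a set \<Rightarrow> 'a set" where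
  "conj_set G g H = (\<lambda>h. g \<otimes>\<^bsub>G\<^esub> h \<otimes>\<^bsub>G\<^esub> inv\<^bsub>G\<^esub> g) ` H"

definition commensurated :: "('a, 'b) monoid_scheme \<Rightarrow> 'a set \<Rightarrow> bool" where
  "commensurated G H \<longleftrightarrow> (\<forall>g\<in>carrier G.
     finite_index G (conj_set G g H \<inter> H) H \<and> finite_index G (conj_set G g H \<inter> H) (conj_set G g H))"

definition locally_elliptic :: "('a, 'b) monoid_scheme \<Rightarrow> 'a topology \<Rightarrow> 'a set \<Rightarrow> bool" where
  "locally_elliptic G T H \<longleftrightarrow>
     (\<forall>F. finite F \<and> F \<subseteq> H \<longrightarrow> compactin T (T closure_of (generate G F)))"

end

theory Submission
  imports Defs
begin

text \<open>
  If u is in H, some power of u lies in the open subgroup Aut, because the closure of the group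
  generated by u is compact. As H contains the transitive group Aut, this forces every element of H
  to be a local isometry: it permutes the balls of level n for all large n, where the bound may
  depend on the element. H is compact as soon as the bound is uniform.

  Let g exchange a ball U of level n with a disjoint ball V of level n + 1. An element of H whose
  conjugate by g is again a local isometry must preserve U. Hence by commensuration the H-orbit of U
  is finite, and the invariant partition this yields is, by the transitivity properties of Aut, the
  partition into balls of some level at least n. So H preserves the balls of arbitrarily large levels.
  On the other hand, if j is large and an element of H fails to permute the balls of level j, a
  commensurability argument and conjugation by a suitable g give an element of H that fails to
  permute the balls of level j + 1, and then all levels from j on are violated. Hence all large
  levels are preserved by the whole of H.
\<close>

section \<open>Rays and levels\<close>

text \<open>In the tree: both rays pass through the same vertex at distance n from the root. The
  classes are the balls of level n, and all metric notions are reduced to these nested equivalence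
  relations.\<close>

definition agree :: "nat \<Rightarrow> ray \<Rightarrow> ray \<Rightarrow> bool" where
  "agree n x y \<longleftrightarrow> (\<forall>i<n. x i = y i)"

lemma agree_refl [simp]: "agree n x x"
  by (simp add: agree_def)

lemma agree_sym: "agree n x y \<Longrightarrow> agree n y x"
  by (simp add: agree_def)

lemma agree_commute: "agree n x y \<longleftrightarrow> agree n y x"
  by (auto simp: agree_def)

lemma agree_trans: "agree n x y \<Longrightarrow> agree n y z \<Longrightarrow> agree n x z"
  by (simp add: agree_def)

lemma agree_mono: "agree n x y \<Longrightarrow> m \<le> n \<Longrightarrow> agree m x y"
  by (simp add: agree_def)

lemma agree_all_eq: "(\<And>n. agree n x y) \<Longrightarrow> x = y"
  by (metis agree_def ext lessI)

lemma agree_iff_le_Least: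
  assumes "x \<noteq> y"
  shows "agree n x y \<longleftrightarrow> n \<le> (LEAST i. x i \<noteq> y i)"
proof -
  from assms have "\<exists>i. x i \<noteq> y i" by auto
  then have "x (LEAST i. x i \<noteq> y i) \<noteq> y (LEAST i. x i \<noteq> y i)" by (rule LeastI_ex)
  then show ?thesis
    unfolding agree_def by (metis (mono_tags, lifting) leI not_less_Least order.strict_trans2)
qed

text \<open>Completeness of the boundary: every coordinate is eventually constant. The index
  \<open>Suc i\<close> makes coordinate i final even for \<open>M = 0\<close>. The explicit formula
  serves to check that limits of boundary rays are boundary rays.\<close>

lemma limit_of_agreeing_sequence:
  assumes "\<And>n. agree (M + n) (s n) (s (Suc n))"
  obtains x where "\<And>n. agree (M + n) (s n) x" "\<And>i. x i = s (Suc i) i"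
proof -
  define x where "x = (\<lambda>i. s (Suc i) i)"
  have step: "agree (M + n) (s n) (s (n + j))" for n j
  proof (induction j)
    case (Suc j)
    have "agree (M + n) (s (n + j)) (s (Suc (n + j)))"
      by (rule agree_mono[OF assms]) simp
    then show ?case using Suc agree_trans by (metis add_Suc_right)
  qed simp
  have "agree (M + n) (s n) x" for n
    unfolding agree_def
  proof (intro allI impI)
    fix i assume i: "i < M + n"
    show "s n i = x i"
    proof (cases "n \<le> Suc i")
      case True
      then show ?thesis using step[of n "Suc i - n"] i by (simp add: agree_def x_def)
    next
      case False
      then show ?thesis using step[of "Suc i" "n - Suc i"] by (simp add: agree_def x_def)
    qed
  qed
  moreover have "x i = s (Suc i) i" for i by (simp add: x_def)
  ultimately show ?thesis using that by blast
qed

section \<open>Permutations of the boundary and the balls they permute\<close>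

definition bperm :: "nat \<Rightarrow> nat \<Rightarrow> amap \<Rightarrow> bool" where
  "bperm d k h \<longleftrightarrow> bij_betw h (bdry d k) (bdry d k) \<and> (\<forall>x. x \<notin> bdry d k \<longrightarrow> h x = x)"

text \<open>For a permutation of the boundary this means that it permutes the balls of level n.
  Levels are treated one at a time, since the balls of one level may be permuted and those of
  another not.\<close>

definition pres :: "nat \<Rightarrow> nat \<Rightarrow> nat \<Rightarrow> amap \<Rightarrow> bool" where
  "pres d k n h \<longleftrightarrow> (\<forall>x\<in>bdry d k. \<forall>y\<in>bdry d k. agree n (h x) (h y) \<longleftrightarrow> agree n x y)"

lemma bperm_in: "bperm d k h \<Longrightarrow> x \<in> bdry d k \<Longrightarrow> h x \<in> bdry d k"
  by (auto simp: bperm_def bij_betw_def)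

lemma bperm_out: "bperm d k h \<Longrightarrow> x \<notin> bdry d k \<Longrightarrow> h x = x"
  by (auto simp: bperm_def)

lemma bperm_bij:
  assumes "bperm d k h"
  shows "bij h"
proof -
  have "bij_betw h (- bdry d k) (- bdry d k)"
    using assms by (auto simp: bperm_def bij_betw_def inj_on_def image_iff)
  then have "bij_betw h (bdry d k \<union> - bdry d k) (bdry d k \<union> - bdry d k)"
    using assms by (intro bij_betw_combine) (auto simp: bperm_def)
  then show ?thesis by simp
qed

lemma bperm_inv:
  assumes "bperm d k h"
  shows "bperm d k (inv_into UNIV h)"
proof -
  note b = bperm_bij[OF assms]
  have "inv_into UNIV h x \<in> bdry d k" if "x \<in> bdry d k" for x
    using that assms b by (metis bij_inv_eq_iff bperm_out)
  moreover have "\<exists>y\<in>bdry d k. inv_into UNIV h y = x" if "x \<in> bdry d k" for x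
    using that assms b by (metis bij_inv_eq_iff bperm_in)
  moreover have "inj_on (inv_into UNIV h) (bdry d k)"
    using b by (metis bij_imp_bij_inv bij_is_inj inj_on_subset subset_UNIV)
  moreover have "inv_into UNIV h x = x" if "x \<notin> bdry d k" for x
    using that assms b by (metis bij_inv_eq_iff bperm_out)
  ultimately show ?thesis unfolding bperm_def bij_betw_def by (auto simp: image_iff)
qed

lemma bperm_comp: "bperm d k g \<Longrightarrow> bperm d k h \<Longrightarrow> bperm d k (g \<circ> h)"
  unfolding bperm_def by (auto intro: bij_betw_trans)

lemma bperm_involution:
  assumes "\<And>x. x \<in> bdry d k \<Longrightarrow> h x \<in> bdry d k" "\<And>x. x \<in> bdry d k \<Longrightarrow> h (h x) = x"
    "\<And>x. x \<notin> bdry d k \<Longrightarrow> h x = x"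
  shows "bperm d k h"
  unfolding bperm_def using assms by (auto intro!: bij_betw_byWitness[where f' = h])

lemma presD:
  "pres d k n h \<Longrightarrow> x \<in> bdry d k \<Longrightarrow> y \<in> bdry d k \<Longrightarrow> agree n (h x) (h y) \<longleftrightarrow> agree n x y"
  by (auto simp: pres_def)

lemma pres_comp: "bperm d k h \<Longrightarrow> pres d k n g \<Longrightarrow> pres d k n h \<Longrightarrow> pres d k n (g \<circ> h)"
  using bperm_in by (fastforce simp: pres_def)

lemma pres_inv:
  assumes "bperm d k h" "pres d k n h"
  shows "pres d k n (inv_into UNIV h)"
  unfolding pres_def
proof (intro ballI)
  fix x y assume xy: "x \<in> bdry d k" "y \<in> bdry d k"
  have "agree n (h (inv_into UNIV h x)) (h (inv_into UNIV h y)) \<longleftrightarrow> agree n (inv_into UNIV h x) (inv_into UNIV h y)"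
    using assms xy bperm_in[OF bperm_inv] presD by metis
  then show "agree n (inv_into UNIV h x) (inv_into UNIV h y) \<longleftrightarrow> agree n x y"
    using bperm_bij[OF assms(1)] by (simp add: bij_is_surj surj_f_inv_f)
qed

section \<open>Finite words as representatives of the balls of a level\<close>

definition trunc :: "nat \<Rightarrow> ray \<Rightarrow> ray" where
  "trunc n x = (\<lambda>i. if i < n then x i else 0)"

text \<open>Padding with child 0 selects one ray from each ball of level n, so that a finite set of
  rays stands in for the set of balls.\<close>

definition words :: "nat \<Rightarrow> nat \<Rightarrow> nat \<Rightarrow> ray set" where
  "words d k n = {x \<in> bdry d k. \<forall>i\<ge>n. x i = 0}"

lemma agree_trunc [simp]: "agree n x (trunc n x)" "agree n (trunc n x) x"
  by (auto simp: agree_def trunc_def)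

lemma trunc_eq_iff: "trunc n x = trunc n y \<longleftrightarrow> agree n x y"
  by (auto simp: agree_def trunc_def fun_eq_iff)

lemma trunc_words: "x \<in> words d k n \<Longrightarrow> trunc n x = x"
  by (auto simp: words_def trunc_def)

lemma finite_words: "finite (words d k n)"
proof -
  have "words d k n \<subseteq> {f. \<forall>i. (i \<in> {..<n} \<longrightarrow> f i \<in> {..<d + k}) \<and> (i \<notin> {..<n} \<longrightarrow> f i = 0)}"
  proof
    fix f assume f: "f \<in> words d k n"
    have "f i < d + k" for i
      using f by (cases "i = 0") (auto simp: words_def bdry_def trans_less_add1 trans_less_add2)
    with f show "f \<in> {f. \<forall>i. (i \<in> {..<n} \<longrightarrow> f i \<in> {..<d + k}) \<and> (i \<notin> {..<n} \<longrightarrow> f i = 0)}"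
      by (auto simp: words_def)
  qed
  then show ?thesis
    using finite_set_of_finite_funs[of "{..<n}" "{..<d+k}" 0] finite_subset by blast
qed

locale tree_boundary =
  fixes d k :: nat
  assumes d2: "d \<ge> 2" and k2: "k \<ge> 2"
begin

lemma trunc_in_words: "x \<in> bdry d k \<Longrightarrow> trunc n x \<in> words d k n"
  using d2 k2 by (auto simp: words_def trunc_def bdry_def)

lemma words_sub: "x \<in> words d k n \<Longrightarrow> x \<in> bdry d k"
  by (auto simp: words_def)

text \<open>A permutation that maps level-n balls into level-n balls induces a surjection of the
  finite set of these balls, hence a bijection.\<close>
lemma pres_if_agree_imp:
  assumes h: "bperm d k h"
    and imp: "\<And>x y. x \<in> bdry d k \<Longrightarrow> y \<in> bdry d k \<Longrightarrow> agree n x y \<Longrightarrow> agree n (h x) (h y)"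
  shows "pres d k n h"
proof -
  let ?W = "words d k n" and ?f = "\<lambda>r. trunc n (h r)"
  have sub: "?f ` ?W \<subseteq> ?W"
    using trunc_in_words bperm_in[OF h] words_sub by auto
  have "?W \<subseteq> ?f ` ?W"
  proof
    fix r assume r: "r \<in> ?W"
    then obtain x where x: "x \<in> bdry d k" "r = h x"
      using h words_sub[OF r] by (auto simp: bperm_def bij_betw_def)
    have "agree n (h x) (h (trunc n x))"
      using imp x(1) trunc_in_words words_sub by (meson agree_trunc(1))
    then have "r = ?f (trunc n x)" using trunc_words[OF r] x trunc_eq_iff by metis
    then show "r \<in> ?f ` ?W" using trunc_in_words x by blast
  qed
  with sub have "?f ` ?W = ?W" by blast
  then have inj: "inj_on ?f ?W" by (simp add: eq_card_imp_inj_on finite_words)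
  have "agree n x y" if xy: "x \<in> bdry d k" "y \<in> bdry d k" "agree n (h x) (h y)" for x y
  proof -
    have "agree n (h x) (h (trunc n x))" "agree n (h y) (h (trunc n y))"
      using imp xy trunc_in_words words_sub by (meson agree_trunc(1))+
    then have "?f (trunc n x) = ?f (trunc n y)"
      using xy(3) by (metis trunc_eq_iff)
    then have "trunc n x = trunc n y" using inj xy trunc_in_words by (auto dest: inj_onD)
    then show ?thesis by (simp add: trunc_eq_iff)
  qed
  then show ?thesis using imp by (auto simp: pres_def)
qed

section \<open>Distances expressed through levels\<close>

lemma inverse_d: "0 < inverse (real d)" "inverse (real d) < 1"
  using d2 by (auto simp: field_simps)

lemma tdist_le_iff: "tdist d x y \<le> inverse (real d) ^ n \<longleftrightarrow> agree n x y"
  using inverse_d agree_iff_le_Least[of x y n]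
  by (auto simp: tdist_def power_decreasing_iff)

text \<open>Positive distances are powers of 1/d, so strictness gains one level: an open ball whose
  radius is the n-th power is a ball of level n + 1.\<close>

lemma tdist_less_iff: "tdist d x y < inverse (real d) ^ n \<longleftrightarrow> agree (Suc n) x y"
  using inverse_d agree_iff_le_Least[of x y "Suc n"]
  by (auto simp: tdist_def power_strict_decreasing_iff Suc_le_eq)

lemma tdist_eq_0_iff: "tdist d x y = 0 \<longleftrightarrow> x = y"
  using d2 by (auto simp: tdist_def)

lemma tdist_nonneg: "tdist d x y \<ge> 0"
  by (auto simp: tdist_def)

lemma tdist_shift:
  assumes "\<And>m. agree (Suc m) x' y' \<longleftrightarrow> agree m x y"
  shows "tdist d x' y' = inverse (real d) * tdist d x y"
proof (cases "x = y")
  case True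
  then have "x' = y'" using assms by (metis agree_all_eq agree_def agree_mono le_SucI agree_refl le_refl)
  with True show ?thesis by (simp add: tdist_def)
next
  case False
  have ne: "x' \<noteq> y'" using False assms agree_all_eq agree_refl by metis
  let ?N = "LEAST i. x i \<noteq> y i" and ?N' = "LEAST i. x' i \<noteq> y' i"
  have *: "Suc m \<le> ?N' \<longleftrightarrow> m \<le> ?N" for m
    using assms agree_iff_le_Least[OF False] agree_iff_le_Least[OF ne] by metis
  have "?N' = Suc ?N" using *[of ?N] *[of "Suc ?N"] by simp
  then show ?thesis using False ne by (simp add: tdist_def)
qed

lemma tdist_eqI:
  assumes "\<And>m. agree m x' y' \<longleftrightarrow> agree m x y"
  shows "tdist d x' y' = tdist d x y"
proof (cases "x = y")
  case True
  then have "x' = y'" using assms agree_all_eq agree_refl by metis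
  with True show ?thesis by (simp add: tdist_def)
next
  case False
  have ne: "x' \<noteq> y'" using False assms agree_all_eq agree_refl by metis
  have "(LEAST i. x i \<noteq> y i) = (LEAST i. x' i \<noteq> y' i)"
    using assms agree_iff_le_Least[OF False] agree_iff_le_Least[OF ne] by (metis order_antisym order_refl)
  then show ?thesis using False ne by (simp add: tdist_def)
qed

text \<open>Distances and levels of agreement determine each other. Elements of \<open>H\<close>
  will turn out to satisfy the right-hand side from some level on.\<close>

lemma Aut_iff: "g \<in> Aut d k \<longleftrightarrow> bperm d k g \<and> (\<forall>n. pres d k n g)"
proof
  assume g: "g \<in> Aut d k"
  then show "bperm d k g \<and> (\<forall>n. pres d k n g)"
    using tdist_le_iff by (auto simp: Aut_def bperm_def pres_def) (metis)+
next
  assume "bperm d k g \<and> (\<forall>n. pres d k n g)"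
  then show "g \<in> Aut d k"
    by (auto simp: Aut_def bperm_def pres_def intro!: tdist_eqI)
qed

lemma Aut_inv: "a \<in> Aut d k \<Longrightarrow> inv_into UNIV a \<in> Aut d k"
  by (simp add: Aut_iff bperm_inv pres_inv)

lemma Aut_comp: "a \<in> Aut d k \<Longrightarrow> b \<in> Aut d k \<Longrightarrow> a \<circ> b \<in> Aut d k"
  by (simp add: Aut_iff bperm_comp pres_comp)

lemma id_Aut: "id \<in> Aut d k"
  by (auto simp: Aut_iff bperm_def pres_def)

lemma AAut_bperm: "g \<in> AAut d k \<Longrightarrow> bperm d k g"
  by (auto simp: AAut_def homeo_bdry_def bperm_def)

text \<open>Every vertex has at least two children because d, k \<ge> 2, so a ray can be left at any
  prescribed level.\<close>

lemma change_coord: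
  assumes "x \<in> bdry d k"
  obtains y where "y \<in> bdry d k" "agree m x y" "x m \<noteq> y m" "y \<noteq> x" "\<not> agree (Suc m) x y"
proof -
  define y where "y = x(m := if x m = 0 then 1 else 0)"
  have "y \<in> bdry d k" using assms d2 k2 by (auto simp: y_def bdry_def)
  moreover have "agree m x y" "x m \<noteq> y m" by (auto simp: y_def agree_def)
  ultimately show ?thesis using that by (metis agree_def lessI)
qed

text \<open>A partition into finitely many balls has a level M so fine that each ball of level M
  lies in one piece and inherits the ratio of that piece.\<close>

lemma AAut_homothety_level:
  assumes "g \<in> AAut d k"
  obtains M where "\<And>x. x \<in> bdry d k \<Longrightarrow> \<exists>c>0. \<forall>y\<in>bdry d k. \<forall>z\<in>bdry d k.
    agree M x y \<longrightarrow> agree M x z \<longrightarrow> tdist d (g y) (g z) = c * tdist d y z"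
proof -
  from assms obtain P where P: "finite P" "\<forall>B\<in>P. proper_ball d k B" "\<Union>P = bdry d k"
    "\<forall>B\<in>P. homothety_on d B g"
    by (auto simp: AAut_def)
  have "\<exists>M. \<forall>y\<in>B. \<forall>z\<in>bdry d k. agree M y z \<longrightarrow> z \<in> B" if "B \<in> P" for B
  proof -
    from that P(2) have "proper_ball d k B" by blast
    then obtain x r where B: "r > 0" "B = {y\<in>bdry d k. tdist d x y < r}"
      unfolding proper_ball_def by blast
    obtain M where M: "inverse (real d) ^ M < r" using inverse_d B(1) real_arch_pow_inv by blast
    have "tdist d x z < r" if "tdist d x y < r" "agree M y z" for y z
    proof (cases "agree M x z")
      case True
      then show ?thesis using M tdist_le_iff by (metis order.strict_trans1)
    next
      case False
      \<comment> \<open>Ultrametric property: z leaves x before level M while y and z still agree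
        there, so x parts from both at the same vertex.\<close>
      have "agree m x y \<longleftrightarrow> agree m x z" for m
        using that(2) False by (metis agree_mono agree_sym agree_trans linear)
      then have "tdist d x y = tdist d x z" by (intro tdist_eqI)
      with that show ?thesis by simp
    qed
    then show ?thesis using B(2) by auto
  qed
  then obtain L where L: "\<And>B y z. B \<in> P \<Longrightarrow> y \<in> B \<Longrightarrow> z \<in> bdry d k \<Longrightarrow> agree (L B) y z \<Longrightarrow> z \<in> B"
    by metis
  define M where "M = Max (insert 0 (L ` P))"
  show ?thesis
  proof (rule that[of M])
    fix x assume "x \<in> bdry d k"
    then obtain B where B: "B \<in> P" "x \<in> B" using P(3) by blast
    have "L B \<le> M" using P(1) B by (simp add: M_def)
    then have *: "z \<in> B" if "z \<in> bdry d k" "agree M x z" for z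
      using L[OF B that(1)] that(2) agree_mono by blast
    from B P(4) obtain c where "c > 0" "\<forall>x\<in>B. \<forall>y\<in>B. tdist d (g x) (g y) = c * tdist d x y"
      by (auto simp: homothety_on_def)
    then show "\<exists>c>0. \<forall>y\<in>bdry d k. \<forall>z\<in>bdry d k.
      agree M x y \<longrightarrow> agree M x z \<longrightarrow> tdist d (g y) (g z) = c * tdist d y z"
      using * by blast
  qed
qed

section \<open>Automorphisms moving rays\<close>

text \<open>For an involution bijectivity is automatic, and \<open>pres_if_agree_imp\<close> reduces
  the isometry property to one implication.\<close>

lemma Aut_involution:
  assumes "\<And>x. x \<in> bdry d k \<Longrightarrow> h x \<in> bdry d k" "\<And>x. x \<in> bdry d k \<Longrightarrow> h (h x) = x"
    "\<And>x. x \<notin> bdry d k \<Longrightarrow> h x = x"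
    "\<And>n x y. x \<in> bdry d k \<Longrightarrow> y \<in> bdry d k \<Longrightarrow> agree n x y \<Longrightarrow> agree n (h x) (h y)"
  shows "h \<in> Aut d k"
proof -
  have "bperm d k h" using assms(1-3) by (rule bperm_involution)
  then show ?thesis unfolding Aut_iff using assms(4) pres_if_agree_imp by blast
qed

lemma Aut_transitive:
  assumes "x \<in> bdry d k" "x' \<in> bdry d k"
  obtains a where "a \<in> Aut d k" "a x = x'"
proof -
  \<comment> \<open>Coordinatewise transpositions: each entry of the image depends only on the entry
    at the same place, so common prefixes survive.\<close>
  define a where "a = (\<lambda>z. if z \<in> bdry d k then (\<lambda>j. Transposition.transpose (x j) (x' j) (z j)) else z)"
  have "a z \<in> bdry d k" if "z \<in> bdry d k" for z
    using that assms by (auto simp: a_def bdry_def Transposition.transpose_def)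
  then have "a \<in> Aut d k"
    by (intro Aut_involution) (auto simp: a_def agree_def)
  moreover have "a x = x'" using assms by (auto simp: a_def)
  ultimately show ?thesis using that by blast
qed

text \<open>Entries before i, and rays with entry \<open>x i\<close> at place i, are left alone; on
  other rays the later entries of y and y' are transposed. As \<open>y i\<close> and
  \<open>y' i\<close> both differ from \<open>x i\<close>, the two kinds of rays are not
  mixed.\<close>

lemma Aut_transitive_sphere:
  assumes "x \<in> bdry d k" "y \<in> bdry d k" "y' \<in> bdry d k"
    "agree i x y" "x i \<noteq> y i" "agree i x y'" "x i \<noteq> y' i"
  obtains a where "a \<in> Aut d k" "a x = x" "a y = y'"
proof -
  define a where "a = (\<lambda>z. if z \<in> bdry d k then (\<lambda>j. if j < i \<or> z i = x i then z j
      else Transposition.transpose (y j) (y' j) (z j)) else z)"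
  have cl: "a z \<in> bdry d k" if "z \<in> bdry d k" for z
    using that assms(1-3) by (auto simp: a_def bdry_def Transposition.transpose_def)
  have xi: "a z i = x i \<longleftrightarrow> z i = x i" if "z \<in> bdry d k" for z
    using that assms(5,7) by (auto simp: a_def Transposition.transpose_def)
  have "a (a z) = z" if z: "z \<in> bdry d k" for z
  proof
    fix j
    show "a (a z) j = z j"
      using xi[OF z] cl[OF z] z by (subst (1) a_def) (auto simp: a_def)
  qed
  moreover have "agree n (a z) (a w)" if "z \<in> bdry d k" "w \<in> bdry d k" "agree n z w" for n z w
    using that by (auto simp: a_def agree_def)
  ultimately have "a \<in> Aut d k"
    using cl by (intro Aut_involution) (auto simp: a_def)
  moreover have "a x = x" using assms by (auto simp: a_def)
  moreover have "a y = y'" using assms by (auto simp: a_def agree_def)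
  ultimately show ?thesis using that by blast
qed

section \<open>Exchanging two balls of consecutive levels\<close>

text \<open>Exchanges the prefix of length n of \<open>c\<close> with the prefix of length n + 1 of
  \<open>e\<close>. If the two balls are disjoint, it contracts by 1/d on the first and expands by d
  on the second. Commensuration is applied to these elements.\<close>

definition ball_swap :: "nat \<Rightarrow> ray \<Rightarrow> ray \<Rightarrow> amap" where
  "ball_swap n c e x =
    (if x \<notin> bdry d k then x
     else if agree n c x then (\<lambda>j. if j < Suc n then e j else x (j - 1))
     else if agree (Suc n) e x then (\<lambda>j. if j < n then c j else x (Suc j))
     else x)"

context
  fixes n :: nat and c e :: ray
  assumes n1: "n \<ge> 1" and c: "c \<in> bdry d k" and e: "e \<in> bdry d k" and ce: "c 0 \<noteq> e 0"
begin

lemma disjoint_swapped_balls: "agree n c x \<Longrightarrow> \<not> agree (Suc n) e x"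
  using n1 ce by (force simp: agree_def)

text \<open>As n \<ge> 1, the shifted tails start at index 1 or later, where all entries have the
  same bound d.\<close>

lemma ball_swap_bdry: "x \<in> bdry d k \<Longrightarrow> ball_swap n c e x \<in> bdry d k"
  using n1 c e by (auto simp: ball_swap_def bdry_def)

lemma ball_swap_upper: "x \<in> bdry d k \<Longrightarrow> agree n c x \<Longrightarrow> agree (Suc n) e (ball_swap n c e x)"
  by (auto simp: ball_swap_def agree_def)

lemma ball_swap_lower: "x \<in> bdry d k \<Longrightarrow> agree (Suc n) e x \<Longrightarrow> agree n c (ball_swap n c e x)"
  using disjoint_swapped_balls by (auto simp: ball_swap_def) (auto simp: agree_def)

lemma ball_swap_swap: "ball_swap n c e (ball_swap n c e x) = x"
proof -
  consider "x \<notin> bdry d k" | "x \<in> bdry d k" "agree n c x" | "x \<in> bdry d k" "agree (Suc n) e x"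
    | "x \<in> bdry d k" "\<not> agree n c x" "\<not> agree (Suc n) e x" by blast
  then show ?thesis
  proof cases
    case 2
    let ?y = "ball_swap n c e x"
    have "ball_swap n c e ?y = (\<lambda>j. if j < n then c j else ?y (Suc j))"
      using 2 ball_swap_bdry ball_swap_upper disjoint_swapped_balls by (subst ball_swap_def) auto
    also have "\<dots> = x" using 2 by (auto simp: ball_swap_def agree_def fun_eq_iff)
    finally show ?thesis .
  next
    case 3
    let ?y = "ball_swap n c e x"
    have "ball_swap n c e ?y = (\<lambda>j. if j < Suc n then e j else ?y (j - 1))"
      using 3 ball_swap_bdry ball_swap_lower by (subst ball_swap_def) auto
    also have "\<dots> = x"
    proof
      fix j
      have "?y = (\<lambda>j. if j < n then c j else x (Suc j))"
        using 3 disjoint_swapped_balls by (auto simp: ball_swap_def)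
      then show "(if j < Suc n then e j else ?y (j - 1)) = x j"
        using 3 by (auto simp: agree_def)
    qed
    finally show ?thesis .
  qed (auto simp: ball_swap_def)
qed

lemma ball_swap_agree_upper:
  assumes "x \<in> bdry d k" "y \<in> bdry d k" "agree n c x" "agree n c y"
  shows "agree (Suc m) (ball_swap n c e x) (ball_swap n c e y) \<longleftrightarrow> agree m x y"
proof
  assume "agree m x y"
  then show "agree (Suc m) (ball_swap n c e x) (ball_swap n c e y)"
    using assms by (auto simp: ball_swap_def agree_def)
next
  assume *: "agree (Suc m) (ball_swap n c e x) (ball_swap n c e y)"
  show "agree m x y"
    unfolding agree_def
  proof (intro allI impI)
    fix i assume "i < m"
    with * have "ball_swap n c e x (Suc i) = ball_swap n c e y (Suc i)" by (simp add: agree_def)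
    then show "x i = y i"
      using assms by (cases "i < n") (auto simp: ball_swap_def agree_def)
  qed
qed

lemma ball_swap_agree_lower:
  assumes "x \<in> bdry d k" "y \<in> bdry d k" "agree (Suc n) e x" "agree (Suc n) e y"
  shows "agree m (ball_swap n c e x) (ball_swap n c e y) \<longleftrightarrow> agree (Suc m) x y"
  using ball_swap_agree_upper[of "ball_swap n c e x" "ball_swap n c e y" m] assms
    ball_swap_bdry ball_swap_lower ball_swap_swap by simp

text \<open>From level n + 1 on, both rays lie in the same piece: the ball of \<open>c\<close>,
  where agreement grows, or the complement of both balls, where nothing moves. Only the ball of
  \<open>e\<close> loses a level.\<close>

lemma ball_swap_agree_outside:
  assumes "x \<in> bdry d k" "y \<in> bdry d k" "\<not> agree (Suc n) e x" "agree m x y" "m \<ge> Suc n"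
  shows "agree m (ball_swap n c e x) (ball_swap n c e y)"
proof (cases "agree n c x")
  case True
  then have "agree n c y" using assms(4,5) by (meson Suc_leD agree_mono agree_trans)
  then have "agree (Suc m) (ball_swap n c e x) (ball_swap n c e y)"
    using True assms ball_swap_agree_upper by blast
  then show ?thesis by (rule agree_mono) simp
next
  case False
  then have "\<not> agree n c y" "\<not> agree (Suc n) e y"
    using assms(3-5) by (meson Suc_leD agree_mono agree_trans agree_sym)+
  with False assms show ?thesis by (simp add: ball_swap_def)
qed

lemma ball_swap_bperm: "bperm d k (ball_swap n c e)"
proof (rule bperm_involution)
  show "ball_swap n c e x = x" if "x \<notin> bdry d k" for x
    using that by (simp add: ball_swap_def)
qed (simp_all add: ball_swap_bdry ball_swap_swap)

lemma ball_swap_continuous: "continuous_bdry d k (ball_swap n c e)"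
  unfolding continuous_bdry_def
proof (intro ballI allI impI)
  fix x and \<epsilon> :: real assume x: "x \<in> bdry d k" and "\<epsilon> > 0"
  then obtain m where m: "inverse (real d) ^ m < \<epsilon>" using inverse_d real_arch_pow_inv by blast
  define M where "M = Suc (max m n)"
  have "tdist d (ball_swap n c e x) (ball_swap n c e y) < \<epsilon>"
    if y: "y \<in> bdry d k" "tdist d x y < inverse (real d) ^ M" for y
  proof -
    \<comment> \<open>One level more than required, which pays for the level lost on the ball of
      \<open>e\<close>.\<close>
    have a: "agree (Suc M) x y" using y tdist_less_iff by blast
    have "agree M (ball_swap n c e x) (ball_swap n c e y)"
    proof (cases "agree (Suc n) e x")
      case True
      then have "agree (Suc n) e y" using agree_trans agree_mono[OF a, of "Suc n"] by (auto simp: M_def)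
      then show ?thesis using True a x y ball_swap_agree_lower by blast
    next
      case False
      then have "agree (Suc M) (ball_swap n c e x) (ball_swap n c e y)"
        using a x y by (intro ball_swap_agree_outside) (auto simp: M_def)
      then show ?thesis by (rule agree_mono) simp
    qed
    then have "agree m (ball_swap n c e x) (ball_swap n c e y)"
      by (rule agree_mono) (simp add: M_def)
    then show ?thesis using m tdist_le_iff by (metis order.strict_trans1)
  qed
  then show "\<exists>\<delta>>0. \<forall>y\<in>bdry d k. tdist d x y < \<delta> \<longrightarrow>
      tdist d (ball_swap n c e x) (ball_swap n c e y) < \<epsilon>"
    using inverse_d by (meson zero_less_power)
qed

text \<open>A ball of level n + 1 lies in the ball of \<open>c\<close>, equals the ball of
  \<open>e\<close>, or misses both; the ratios are 1/d, d and 1.\<close>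

lemma ball_swap_homothety:
  assumes x: "x \<in> bdry d k"
  shows "homothety_on d {y \<in> bdry d k. agree (Suc n) x y} (ball_swap n c e)"
proof -
  let ?B = "{y \<in> bdry d k. agree (Suc n) x y}" and ?g = "ball_swap n c e"
  consider (U) "agree n c x" | (V) "agree (Suc n) e x" | (N) "\<not> agree n c x" "\<not> agree (Suc n) e x"
    by blast
  then show ?thesis
  proof cases
    case U
    have "agree n c y" if "y \<in> ?B" for y
      using that U by (metis (no_types, lifting) Suc_leD agree_mono agree_trans le_refl mem_Collect_eq)
    then have "tdist d (?g y) (?g z) = inverse (real d) * tdist d y z" if "y \<in> ?B" "z \<in> ?B" for y z
      using that by (intro tdist_shift ball_swap_agree_upper) auto
    then show ?thesis unfolding homothety_on_def using inverse_d by blast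
  next
    case V
    have "agree (Suc n) e y" if "y \<in> ?B" for y
      using that V agree_trans by blast
    then have "tdist d y z = inverse (real d) * tdist d (?g y) (?g z)" if "y \<in> ?B" "z \<in> ?B" for y z
      using that by (intro tdist_shift ball_swap_agree_lower[symmetric]) auto
    then have "tdist d (?g y) (?g z) = real d * tdist d y z" if "y \<in> ?B" "z \<in> ?B" for y z
      using that d2 by (simp add: field_simps)
    then show ?thesis unfolding homothety_on_def using d2 by (intro exI[of _ "real d"]) auto
  next
    case N
    have "\<not> agree n c y \<and> \<not> agree (Suc n) e y" if "y \<in> ?B" for y
      using that N by (metis (no_types, lifting) Suc_leD agree_mono agree_sym agree_trans le_refl mem_Collect_eq)
    then have "?g y = y" if "y \<in> ?B" for y using that by (auto simp: ball_swap_def)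
    then show ?thesis unfolding homothety_on_def by (intro exI[of _ 1]) auto
  qed
qed

text \<open>The partition used is the one into all balls of level n + 1. They are proper since the
  root has at least two children.\<close>

lemma ball_swap_AAut: "ball_swap n c e \<in> AAut d k"
proof -
  let ?g = "ball_swap n c e" and ?D = "bdry d k"
  let ?ball = "\<lambda>x. {y \<in> ?D. agree (Suc n) x y}"
  have bij: "bij_betw ?g ?D ?D" using ball_swap_bperm by (simp add: bperm_def)
  have "inv_into ?D ?g y = ?g y" if "y \<in> ?D" for y
    using bij that ball_swap_bdry ball_swap_swap
    by (intro inv_into_f_eq) (auto simp: bij_betw_def)
  then have "continuous_bdry d k (inv_into ?D ?g)"
    using ball_swap_continuous unfolding continuous_bdry_def by simp
  then have homeo: "homeo_bdry d k ?g"
    using ball_swap_continuous ball_swap_bperm by (auto simp: homeo_bdry_def bperm_def)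
  have fin: "finite (?ball ` ?D)"
  proof (rule finite_subset)
    show "?ball ` ?D \<subseteq> ?ball ` words d k (Suc n)"
    proof
      fix B assume "B \<in> ?ball ` ?D"
      then obtain x where x: "x \<in> ?D" "B = ?ball x" by blast
      have "B = ?ball (trunc (Suc n) x)"
        unfolding x(2) using agree_trans agree_trunc by blast
      then show "B \<in> ?ball ` words d k (Suc n)" using trunc_in_words x(1) by blast
    qed
  qed (simp add: finite_words)
  have proper: "proper_ball d k (?ball x)" if x: "x \<in> ?D" for x
  proof -
    obtain y where "y \<in> ?D" "x 0 \<noteq> y 0" using change_coord[OF x, of 0] by metis
    then have "?ball x \<noteq> ?D" by (auto simp: agree_def)
    moreover have "?ball x = {y \<in> ?D. tdist d x y < inverse (real d) ^ n}"
      by (simp add: tdist_less_iff)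
    moreover have "inverse (real d) ^ n > 0" using inverse_d by simp
    ultimately show ?thesis
      unfolding proper_ball_def using x by blast
  qed
  have disj: "A \<inter> B = {}" if "A \<in> ?ball ` ?D" "B \<in> ?ball ` ?D" "A \<noteq> B" for A B
  proof (rule ccontr)
    assume "A \<inter> B \<noteq> {}"
    moreover from that obtain x y where xy: "A = ?ball x" "B = ?ball y" by blast
    ultimately obtain z where "agree (Suc n) x z" "agree (Suc n) y z" by blast
    then have "?ball x = ?ball y" using agree_trans agree_sym by blast
    with xy that show False by simp
  qed
  have cover: "\<Union> (?ball ` ?D) = ?D" by auto
  have hom: "homothety_on d B ?g" if "B \<in> ?ball ` ?D" for B
    using that ball_swap_homothety by blast
  show ?thesis
    unfolding AAut_def
  proof (intro CollectI conjI exI)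
    show "\<forall>B\<in>?ball ` ?D. proper_ball d k B" using proper by blast
    show "\<forall>A\<in>?ball ` ?D. \<forall>B\<in>?ball ` ?D. A \<noteq> B \<longrightarrow> A \<inter> B = {}" using disj by blast
    show "\<forall>B\<in>?ball ` ?D. homothety_on d B ?g" using hom by blast
  qed (fact homeo fin cover)+
qed

text \<open>The swap is an involution and left inverses are unique; conjugation by it thus takes the
  form g h g.\<close>

lemma inv_ball_swap: "inv\<^bsub>AAutG d k\<^esub> (ball_swap n c e) = ball_swap n c e"
proof -
  have *: "ball_swap n c e \<circ> ball_swap n c e = id" using ball_swap_swap by auto
  have "y = ball_swap n c e" if "y \<circ> ball_swap n c e = id" for y
    using that * by (metis comp_assoc comp_id id_comp)
  then show ?thesis
    unfolding m_inv_def AAutG_def using * ball_swap_AAut by (intro the_equality) auto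
qed

text \<open>A conjugate of l by the swap can be a local isometry only if l maps the ball of c into
  itself: anywhere else the contraction by the swap at x is not compensated at the image of x.\<close>
lemma ball_swap_conj_upper:
  assumes l: "\<And>m. m \<ge> M \<Longrightarrow> pres d k m l" and h: "\<And>m. m \<ge> M \<Longrightarrow> pres d k m h"
    and hb: "bperm d k h"
    and eq: "l = ball_swap n c e \<circ> h \<circ> ball_swap n c e"
    and x: "x \<in> bdry d k" "agree n c x"
  shows "agree n c (l x)" "agree (Suc n) e (h (ball_swap n c e x))"
proof -
  let ?g = "ball_swap n c e"
  \<comment> \<open>\<open>M\<close> lets l and h respect level m + 1; \<open>Suc n\<close> keeps y
    in the ball of \<open>c\<close> and permits \<open>ball_swap_agree_outside\<close>.\<close>
  define m where "m = max M (Suc n)"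
  obtain y where y: "y \<in> bdry d k" "agree m x y" "\<not> agree (Suc m) x y"
    using change_coord[OF x(1)] by metis
  have "agree n c y" by (rule agree_trans[OF x(2) agree_mono[OF y(2)]]) (simp add: m_def)
  then have "agree (Suc m) (?g x) (?g y)" using ball_swap_agree_upper x y by blast
  then have hh: "agree (Suc m) (h (?g x)) (h (?g y))"
    using h[of "Suc m"] presD ball_swap_bdry x y by (simp add: m_def pres_def)
  show *: "agree (Suc n) e (h (?g x))"
  proof (rule ccontr)
    assume "\<not> ?thesis"
    then have "agree (Suc m) (l x) (l y)"
      using hh x y hb ball_swap_bdry bperm_in unfolding eq comp_def
      by (intro ball_swap_agree_outside) (auto simp: m_def)
    then have "agree (Suc m) x y"
      using l[of "Suc m"] x y by (simp add: m_def pres_def)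
    with y show False by simp
  qed
  show "agree n c (l x)"
    unfolding eq comp_def using * x hb ball_swap_bdry bperm_in by (intro ball_swap_lower) auto
qed

text \<open>The converse direction is \<open>ball_swap_conj_upper\<close> for the inverse of l,
  which is the conjugate by the swap of the inverse of h.\<close>

lemma ball_swap_conj_iff:
  assumes l: "\<And>m. m \<ge> M \<Longrightarrow> pres d k m l" and h: "\<And>m. m \<ge> M \<Longrightarrow> pres d k m h"
    and lb: "bperm d k l" and hb: "bperm d k h"
    and eq: "l = ball_swap n c e \<circ> h \<circ> ball_swap n c e"
    and x: "x \<in> bdry d k"
  shows "agree n c (l x) \<longleftrightarrow> agree n c x"
proof
  let ?g = "ball_swap n c e"
  have gg: "inv_into UNIV ?g = ?g"
    using ball_swap_swap by (intro inv_unique_comp) auto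
  note bg = bperm_bij[OF ball_swap_bperm] and bh = bperm_bij[OF hb] and bl = bperm_bij[OF lb]
  have "inv_into UNIV l = ?g \<circ> inv_into UNIV h \<circ> ?g"
    unfolding eq using bg bh gg by (simp add: o_inv_distrib bij_comp o_assoc)
  moreover assume "agree n c (l x)"
  ultimately have "agree n c (inv_into UNIV l (l x))"
    using ball_swap_conj_upper(1)[of M "inv_into UNIV l" "inv_into UNIV h" "l x",
      OF pres_inv[OF lb l] pres_inv[OF hb h] bperm_inv[OF hb]] bperm_in[OF lb x] by blast
  then show "agree n c x" using bl by (simp add: bij_is_inj inv_f_f)
qed (use ball_swap_conj_upper(1)[OF l h hb eq x] in auto)

end

end

section \<open>The theorem\<close>

locale elliptic_overgroup = tree_boundary +
  fixes H :: "amap set"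
  assumes subgroup_H: "subgroup H (AAutG d k)"
    and elliptic_H: "locally_elliptic (AAutG d k) (AAut_top d k) H"
    and Aut_sub: "Aut d k \<subseteq> H"
begin

lemma H_AAut: "h \<in> H \<Longrightarrow> h \<in> AAut d k"
  using subgroup.subset[OF subgroup_H] by (auto simp: AAutG_def)

lemma H_bperm: "h \<in> H \<Longrightarrow> bperm d k h"
  by (simp add: AAut_bperm H_AAut)

lemma H_comp: "g \<in> H \<Longrightarrow> h \<in> H \<Longrightarrow> g \<circ> h \<in> H"
  using subgroup.m_closed[OF subgroup_H] by (simp add: AAutG_def)

lemma id_H: "id \<in> H"
  using id_Aut Aut_sub by blast

lemma H_pow: "h \<in> H \<Longrightarrow> h ^^ n \<in> H"
  by (induction n) (auto simp: id_H H_comp simp flip: id_def)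

lemma level_stab_0: "level_stab d k 0 = Aut d k"
  by (simp add: level_stab_def)

text \<open>Every level stabiliser lies in that of level 0, which is \<open>Aut\<close>. So the
  cosets of \<open>Aut\<close> form an open cover, the one to which compactness is applied in
  \<open>power_in_Aut\<close>.\<close>

lemma topspace_AAut_top: "topspace (AAut_top d k) = (\<Union>g\<in>AAut d k. (\<circ>) g ` Aut d k)"
proof
  have "level_stab d k n \<subseteq> Aut d k" for n by (auto simp: level_stab_def)
  then show "topspace (AAut_top d k) \<subseteq> (\<Union>g\<in>AAut d k. (\<circ>) g ` Aut d k)"
    unfolding AAut_top_def topology_generated_by_topspace by blast
  show "(\<Union>g\<in>AAut d k. (\<circ>) g ` Aut d k) \<subseteq> topspace (AAut_top d k)"
    unfolding AAut_top_def topology_generated_by_topspace level_stab_0[symmetric] by blast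
qed

lemma AAut_sub_topspace: "AAut d k \<subseteq> topspace (AAut_top d k)"
proof
  fix g assume "g \<in> AAut d k"
  moreover have "g = g \<circ> id" by simp
  ultimately show "g \<in> topspace (AAut_top d k)"
    unfolding topspace_AAut_top using id_Aut by blast
qed

text \<open>The closure of the cyclic group generated by u meets only finitely many cosets of the open
  subgroup Aut.\<close>
lemma power_in_Aut:
  assumes u: "u \<in> H"
  obtains p where "p \<ge> 1" "u ^^ p \<in> Aut d k"
proof -
  let ?T = "AAut_top d k" and ?S = "generate (AAutG d k) {u}"
  have pow: "u ^^ n \<in> ?S" for n
  proof (induction n)
    case 0
    then show ?case using generate.one[of "AAutG d k"] by (simp add: AAutG_def id_def)
  next
    case (Suc n)
    have "u \<otimes>\<^bsub>AAutG d k\<^esub> u ^^ n \<in> ?S"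
      by (rule generate.eng[OF generate.incl Suc]) simp
    moreover have "u \<otimes>\<^bsub>AAutG d k\<^esub> u ^^ n = u ^^ Suc n" by (simp add: AAutG_def)
    ultimately show ?case by (simp only:)
  qed
  have comp: "compactin ?T (?T closure_of ?S)"
    using elliptic_H u unfolding locally_elliptic_def by blast
  let ?C = "(\<lambda>g. (\<circ>) g ` Aut d k) ` AAut d k"
  have "openin ?T B" if "B \<in> ?C" for B
    unfolding AAut_top_def
    using that by (intro topology_generated_by_Basis) (auto simp flip: level_stab_0)
  moreover have "?T closure_of ?S \<subseteq> \<Union>?C"
    using closure_of_subset_topspace[of ?T ?S] unfolding topspace_AAut_top by blast
  ultimately obtain F where F: "finite F" "F \<subseteq> ?C" "?T closure_of ?S \<subseteq> \<Union>F"
    using comp unfolding compactin_def by metis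
  have "u ^^ n \<in> \<Union>F" for n
  proof -
    have "u ^^ n \<in> topspace ?T" using H_pow[OF u] H_AAut AAut_sub_topspace by blast
    then have "u ^^ n \<in> ?T closure_of ?S"
      using pow closure_of_subset_Int[of ?T ?S] by blast
    with F show ?thesis by blast
  qed
  then have "\<forall>n. \<exists>A. A \<in> F \<and> u ^^ n \<in> A" by blast
  then obtain A where A: "\<And>n. A n \<in> F" "\<And>n. u ^^ n \<in> A n" by metis
  \<comment> \<open>Pigeonhole: infinitely many exponents, finitely many cosets. Two powers in one
    coset differ by an element of \<open>Aut\<close>.\<close>
  have "\<not> inj A"
    using F(1) A(1) by (metis finite_imageD finite_subset image_subset_iff infinite_UNIV_nat)
  then obtain m n where mn: "A m = A n" "m < n"
    unfolding inj_def by (metis linorder_neqE_nat)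
  have "A m \<in> ?C" using A(1) F(2) by blast
  then obtain g a b where g: "g \<in> AAut d k" and a: "a \<in> Aut d k" "u ^^ m = g \<circ> a"
    and b: "b \<in> Aut d k" "u ^^ n = g \<circ> b"
    using A(2)[of m] A(2)[of n] mn(1) by auto
  have "u ^^ n = u ^^ m \<circ> u ^^ (n - m)" using mn(2) by (simp flip: funpow_add)
  then have "g \<circ> b = g \<circ> (a \<circ> u ^^ (n - m))" using a b by (simp add: comp_assoc)
  moreover have "inj g" using AAut_bperm[OF g] bperm_bij bij_is_inj by blast
  ultimately have ab: "b = a \<circ> u ^^ (n - m)" by (simp add: inj_def fun_eq_iff)
  have "inj a" using a(1) bperm_bij bij_is_inj by (auto simp: Aut_iff)
  then have "inv_into UNIV a \<circ> a = id" by simp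
  then have "u ^^ (n - m) = inv_into UNIV a \<circ> b" unfolding ab by (simp flip: comp_assoc)
  then have "u ^^ (n - m) \<in> Aut d k" using Aut_inv Aut_comp a(1) b(1) by simp
  then show ?thesis using that[of "n - m"] mn by simp
qed

text \<open>Moving h x back to x by an automorphism yields an element of H fixing x with the same ratio
  at x; some power of it is an isometry, so the ratio is 1.\<close>
lemma ratio_eq_1:
  assumes h: "h \<in> H" and x: "x \<in> bdry d k" and c: "c > 0"
    and hom: "\<And>y. y \<in> bdry d k \<Longrightarrow> agree M x y \<Longrightarrow> tdist d (h x) (h y) = c * tdist d x y"
  shows "c = 1"
proof -
  obtain a where a: "a \<in> Aut d k" "a (h x) = x"
    using Aut_transitive bperm_in[OF H_bperm[OF h] x] x by metis
  define u where "u = a \<circ> h"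
  have u: "u \<in> H" using a h Aut_sub H_comp u_def by blast
  have ux: "u x = x" using a by (simp add: u_def)
  have hom_u: "tdist d x (u y) = c * tdist d x y" if "y \<in> bdry d k" "agree M x y" for y
  proof -
    have "tdist d (a (h x)) (a (h y)) = tdist d (h x) (h y)"
      using a(1) bperm_in[OF H_bperm[OF h]] x that by (auto simp: Aut_def)
    then show ?thesis using hom[OF that] a(2) by (simp add: u_def)
  qed
  obtain p where p: "p \<ge> 1" "u ^^ p \<in> Aut d k" using power_in_Aut[OF u] by blast
  \<comment> \<open>Points within r of x stay in the ball of level M, where the ratio c is valid,
    during all p iterations, even if c > 1.\<close>
  define r where "r = inverse (real d) ^ M / (max 1 c) ^ p"
  have "r > 0" using inverse_d c by (simp add: r_def)
  then obtain N where N: "inverse (real d) ^ N < r" using inverse_d real_arch_pow_inv by blast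
  obtain z where z: "z \<in> bdry d k" "agree N x z" "z \<noteq> x" using change_coord[OF x] by metis
  have zr: "tdist d x z \<le> r" using z N tdist_le_iff by (metis less_imp_le order_trans)
  have "tdist d x ((u ^^ i) z) = c ^ i * tdist d x z" if "i \<le> p" for i
    using that
  proof (induction i)
    case (Suc i)
    then have IH: "tdist d x ((u ^^ i) z) = c ^ i * tdist d x z" by simp
    have "c ^ i \<le> max 1 c ^ i" using c by (intro power_mono) auto
    also have "\<dots> \<le> max 1 c ^ p" using Suc by (intro power_increasing) auto
    finally have "c ^ i * tdist d x z \<le> max 1 c ^ p * r"
      using zr c tdist_nonneg by (intro mult_mono) auto
    also have "\<dots> = inverse (real d) ^ M" by (simp add: r_def)
    finally have "agree M x ((u ^^ i) z)" using IH tdist_le_iff by metis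
    then show ?case using hom_u[OF bperm_in[OF H_bperm[OF H_pow[OF u]] z(1)]] IH by simp
  qed simp
  then have "tdist d x ((u ^^ p) z) = c ^ p * tdist d x z" by simp
  moreover have "(u ^^ p) x = x" using ux by (induction p) auto
  then have "tdist d x ((u ^^ p) z) = tdist d x z"
    using p(2) x z(1) by (force simp: Aut_def)
  moreover have "tdist d x z \<noteq> 0" using z(3) tdist_eq_0_iff by metis
  ultimately have "c ^ p = 1" by simp
  then show ?thesis using c p(1) power_eq_imp_eq_base[of c p 1] by simp
qed

text \<open>On balls of a fine enough level M the map is a homothety, of ratio 1 by
  \<open>ratio_eq_1\<close>; an isometry on balls of level M maps smaller balls into balls of the
  same level.\<close>

lemma eventually_pres:
  assumes h: "h \<in> H"
  obtains M where "\<And>n. n \<ge> M \<Longrightarrow> pres d k n h"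
proof -
  obtain M where M: "\<And>x. x \<in> bdry d k \<Longrightarrow> \<exists>c>0. \<forall>y\<in>bdry d k. \<forall>z\<in>bdry d k.
    agree M x y \<longrightarrow> agree M x z \<longrightarrow> tdist d (h y) (h z) = c * tdist d y z"
    using AAut_homothety_level[OF H_AAut[OF h]] by metis
  have iso: "tdist d (h x) (h y) = tdist d x y"
    if xy: "x \<in> bdry d k" "y \<in> bdry d k" "agree M x y" for x y
  proof -
    obtain c where c: "c > 0" "\<And>y. y \<in> bdry d k \<Longrightarrow> agree M x y \<Longrightarrow> tdist d (h x) (h y) = c * tdist d x y"
      using M[OF xy(1)] xy(1) agree_refl by metis
    have "c = 1" using ratio_eq_1[OF h xy(1) c] .
    then show ?thesis using c(2)[OF xy(2,3)] by simp
  qed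
  show ?thesis
  proof (rule that)
    fix n assume n: "n \<ge> M"
    show "pres d k n h"
    proof (rule pres_if_agree_imp[OF H_bperm[OF h]])
      fix x y assume xy: "x \<in> bdry d k" "y \<in> bdry d k" "agree n x y"
      then have "tdist d (h x) (h y) = tdist d x y" using iso agree_mono[OF xy(3) n] by blast
      then show "agree n (h x) (h y)" using xy(3) by (metis tdist_le_iff)
    qed
  qed
qed

lemma eventually_pres_finite:
  assumes "finite F" "F \<subseteq> H"
  obtains M where "\<And>h n. h \<in> F \<Longrightarrow> n \<ge> M \<Longrightarrow> pres d k n h"
proof -
  have "\<forall>h\<in>F. \<exists>M. \<forall>n\<ge>M. pres d k n h" using assms(2) eventually_pres by (metis subsetD)
  then obtain L where L: "\<And>h n. h \<in> F \<Longrightarrow> n \<ge> L h \<Longrightarrow> pres d k n h" by metis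
  have "L h \<le> Max (insert 0 (L ` F))" if "h \<in> F" for h using that assms(1) by simp
  then show ?thesis using that L by (meson order_trans)
qed

end

section \<open>Commensuration tested on swaps\<close>

locale commensurated_overgroup = elliptic_overgroup +
  assumes commensurated_H: "commensurated (AAutG d k) H"
begin

text \<open>The intersection of \<open>H\<close> with its conjugate by the swap, which is its own
  inverse.\<close>

definition swap_stab :: "nat \<Rightarrow> ray \<Rightarrow> ray \<Rightarrow> amap set" where
  "swap_stab n c e = {l \<in> H. \<exists>h\<in>H. l = ball_swap n c e \<circ> h \<circ> ball_swap n c e}"

lemma swap_stab_finite_index:
  assumes "n \<ge> 1" "c \<in> bdry d k" "e \<in> bdry d k" "c 0 \<noteq> e 0"
  shows "finite ((\<lambda>h. (\<lambda>l. l \<circ> h) ` swap_stab n c e) ` H)"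
proof -
  let ?G = "AAutG d k" and ?g = "ball_swap n c e"
  have "conj_set ?G ?g H \<inter> H = swap_stab n c e"
    unfolding conj_set_def inv_ball_swap[OF assms] by (auto simp: AAutG_def swap_stab_def)
  moreover have "?g \<in> carrier ?G" using ball_swap_AAut[OF assms] by (simp add: AAutG_def)
  ultimately have "finite_index ?G (swap_stab n c e) H"
    using commensurated_H unfolding commensurated_def by metis
  moreover have "swap_stab n c e #>\<^bsub>?G\<^esub> h = (\<lambda>l. l \<circ> h) ` swap_stab n c e" for h
    by (auto simp: r_coset_def AAutG_def)
  ultimately show ?thesis by (simp add: finite_index_def)
qed

text \<open>Finitely many subgroups of finite index have common coset representatives: the tuple of
  right cosets of h takes finitely many values, and one h is kept for each.\<close>

lemma swap_stab_reps:
  assumes "finite I" "\<And>i. i \<in> I \<Longrightarrow> n i \<ge> 1" "\<And>i. i \<in> I \<Longrightarrow> c i \<in> bdry d k"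
    "\<And>i. i \<in> I \<Longrightarrow> e i \<in> bdry d k" "\<And>i. i \<in> I \<Longrightarrow> c i 0 \<noteq> e i 0"
  obtains F where "finite F" "F \<subseteq> H"
    "\<And>h. h \<in> H \<Longrightarrow> \<exists>f\<in>F. \<forall>i\<in>I. \<exists>l\<in>swap_stab (n i) (c i) (e i). h = l \<circ> f"
proof -
  define \<phi> where "\<phi> h = (\<lambda>i\<in>I. (\<lambda>l. l \<circ> h) ` swap_stab (n i) (c i) (e i))" for h :: amap
  have "\<phi> ` H \<subseteq> (\<Pi>\<^sub>E i\<in>I. (\<lambda>h. (\<lambda>l. l \<circ> h) ` swap_stab (n i) (c i) (e i)) ` H)"
    by (auto simp: \<phi>_def)
  moreover have "finite (\<Pi>\<^sub>E i\<in>I. (\<lambda>h. (\<lambda>l. l \<circ> h) ` swap_stab (n i) (c i) (e i)) ` H)"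
    using assms swap_stab_finite_index by (intro finite_PiE) auto
  ultimately have "finite (\<phi> ` H)" by (rule finite_subset)
  then obtain F where F: "F \<subseteq> H" "finite F" "\<phi> ` H = \<phi> ` F"
    using finite_subset_image[of "\<phi> ` H" \<phi> H] by blast
  show ?thesis
  proof (rule that[OF F(2,1)])
    fix h assume h: "h \<in> H"
    then obtain f where f: "f \<in> F" "\<phi> h = \<phi> f" using F(3) by blast
    have "\<exists>l\<in>swap_stab (n i) (c i) (e i). h = l \<circ> f" if i: "i \<in> I" for i
    proof -
      \<comment> \<open>The identity lies in the subgroup, so h lies in its own coset and hence in
        that of f.\<close>
      have "(ball_swap (n i) (c i) (e i)) \<circ> id \<circ> (ball_swap (n i) (c i) (e i)) = id"
        using ball_swap_swap assms(2-5) i by auto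
      then have "id \<in> swap_stab (n i) (c i) (e i)"
        using id_H unfolding swap_stab_def by (metis (mono_tags, lifting) mem_Collect_eq)
      then have "id \<circ> h \<in> (\<lambda>l. l \<circ> h) ` swap_stab (n i) (c i) (e i)" by (rule imageI)
      also have "\<dots> = (\<lambda>l. l \<circ> f) ` swap_stab (n i) (c i) (e i)"
        using fun_cong[OF f(2), of i] i by (simp add: \<phi>_def)
      finally show ?thesis by auto
    qed
    with f(1) show "\<exists>f\<in>F. \<forall>i\<in>I. \<exists>l\<in>swap_stab (n i) (c i) (e i). h = l \<circ> f" by blast
  qed
qed

lemma swap_stab_local_isometry:
  assumes "l \<in> swap_stab n c e"
  obtains h M where "h \<in> H" "l = ball_swap n c e \<circ> h \<circ> ball_swap n c e"
    "\<And>m. m \<ge> M \<Longrightarrow> pres d k m l" "\<And>m. m \<ge> M \<Longrightarrow> pres d k m h"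
proof -
  obtain h where h: "h \<in> H" "l \<in> H" "l = ball_swap n c e \<circ> h \<circ> ball_swap n c e"
    using assms by (auto simp: swap_stab_def)
  obtain M where "\<And>f m. f \<in> {h, l} \<Longrightarrow> m \<ge> M \<Longrightarrow> pres d k m f"
    using eventually_pres_finite[of "{h, l}"] h by auto
  then show ?thesis using that[of h M] h by blast
qed

text \<open>The relation "no element of H separates x and y by the ball of c" has finitely many classes and
  is invariant under Aut, which forces it to be the partition into balls of some level.\<close>
lemma preserved_level:
  obtains i where "i \<ge> N" "\<And>h. h \<in> H \<Longrightarrow> pres d k i h"
proof -
  \<comment> \<open>The successor secures n \<ge> 1 for the swap; the level found below is at least
    n, hence at least N.\<close>
  define n where "n = Suc N"
  define c :: ray where "c = (\<lambda>i. 0)"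
  have n1: "n \<ge> 1" by (simp add: n_def)
  have c: "c \<in> bdry d k" using d2 k2 by (simp add: c_def bdry_def)
  obtain e where e: "e \<in> bdry d k" "c 0 \<noteq> e 0" using change_coord[OF c, of 0] by metis
  obtain F where F: "finite F" "F \<subseteq> H" "\<And>h. h \<in> H \<Longrightarrow> \<exists>f\<in>F. \<exists>l\<in>swap_stab n c e. h = l \<circ> f"
    using swap_stab_reps[of "{()}" "\<lambda>_. n" "\<lambda>_. c" "\<lambda>_. e"] n1 c e by auto
  define R where "R x y \<longleftrightarrow> (\<forall>h\<in>H. agree n c (h x) \<longleftrightarrow> agree n c (h y))" for x y
  have R_H: "R (h x) (h y)" if "R x y" "h \<in> H" for h x y
    unfolding R_def
  proof
    fix g assume "g \<in> H"
    then have "g \<circ> h \<in> H" using H_comp that(2) by blast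
    then show "agree n c (g (h x)) \<longleftrightarrow> agree n c (g (h y))"
      using that(1) unfolding R_def by (metis comp_apply)
  qed
  have R_agree: "agree n x y" if xy: "R x y" "x \<in> bdry d k" "y \<in> bdry d k" for x y
  proof -
    obtain a where a: "a \<in> Aut d k" "a x = c" using Aut_transitive xy(2) c by blast
    then have "agree n c (a y)" using xy(1) Aut_sub unfolding R_def by fastforce
    then show ?thesis using a xy by (metis Aut_iff presD)
  qed
  have "\<exists>x\<in>bdry d k. \<exists>y\<in>bdry d k. x \<noteq> y \<and> R x y"
  proof -
    \<comment> \<open>Pigeonhole: the boundary is infinite, whereas membership of h x in the ball of
      \<open>c\<close> is decided by the finitely many f in F, since h = l f with l preserving that
      ball.\<close>
    define \<psi> where "\<psi> x = {f \<in> F. agree n c (f x)}" for x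
    have "inj_on (\<lambda>m::nat. (\<lambda>i. if i = Suc m then 1 else 0 :: nat)) UNIV"
      by (auto simp: inj_on_def fun_eq_iff split: if_splits)
    moreover have "range (\<lambda>m::nat. (\<lambda>i. if i = Suc m then 1 else 0 :: nat)) \<subseteq> bdry d k"
      using d2 k2 by (auto simp: bdry_def)
    ultimately have "infinite (bdry d k)"
      using infinite_UNIV_nat finite_imageD finite_subset by metis
    moreover have "\<psi> ` bdry d k \<subseteq> Pow F" by (auto simp: \<psi>_def)
    then have "finite (\<psi> ` bdry d k)" using F(1) finite_subset by blast
    ultimately have "\<not> inj_on \<psi> (bdry d k)" using finite_imageD by blast
    then obtain x y where xy: "x \<in> bdry d k" "y \<in> bdry d k" "x \<noteq> y" "\<psi> x = \<psi> y"
      by (auto simp: inj_on_def)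
    have "agree n c (h x) \<longleftrightarrow> agree n c (h y)" if h: "h \<in> H" for h
    proof -
      obtain f l where fl: "f \<in> F" "l \<in> swap_stab n c e" "h = l \<circ> f" using F(3)[OF h] by blast
      obtain g M where g: "g \<in> H" "l = ball_swap n c e \<circ> g \<circ> ball_swap n c e"
        "\<And>m. m \<ge> M \<Longrightarrow> pres d k m l" "\<And>m. m \<ge> M \<Longrightarrow> pres d k m g"
        using swap_stab_local_isometry[OF fl(2)] by blast
      have l: "l \<in> H" using fl(2) by (simp add: swap_stab_def)
      have "agree n c (l z) \<longleftrightarrow> agree n c z" if "z \<in> bdry d k" for z
        using ball_swap_conj_iff[OF n1 c e g(3,4) H_bperm[OF l] H_bperm[OF g(1)] g(2) that] by blast
      moreover have "f x \<in> bdry d k" "f y \<in> bdry d k"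
        using fl(1) F(2) xy H_bperm bperm_in by blast+
      moreover have "agree n c (f x) \<longleftrightarrow> agree n c (f y)"
        using xy(4) fl(1) unfolding \<psi>_def by blast
      ultimately show ?thesis using fl(3) by simp
    qed
    then show ?thesis using xy unfolding R_def by blast
  qed
  then obtain x0 y0 where xy0: "x0 \<in> bdry d k" "y0 \<in> bdry d k" "x0 \<noteq> y0" "R x0 y0" by blast
  then have "agree (LEAST i. x0 i \<noteq> y0 i) x0 y0" "\<exists>i. x0 i \<noteq> y0 i"
    using agree_iff_le_Least[of x0 y0] by auto
  then have ex: "\<exists>i. \<exists>x\<in>bdry d k. \<exists>y\<in>bdry d k. R x y \<and> agree i x y \<and> x i \<noteq> y i"
    using xy0 LeastI_ex[of "\<lambda>i. x0 i \<noteq> y0 i"] by blast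
  \<comment> \<open>The first level at which two related rays part; the classes of R will be the
    balls of this level.\<close>
  define i where "i = (LEAST i. \<exists>x\<in>bdry d k. \<exists>y\<in>bdry d k. R x y \<and> agree i x y \<and> x i \<noteq> y i)"
  obtain x y where xy: "x \<in> bdry d k" "y \<in> bdry d k" "R x y" "agree i x y" "x i \<noteq> y i"
    using LeastI_ex[OF ex] unfolding i_def by blast
  have "n \<le> i" using R_agree[OF xy(3,1,2)] xy(5) unfolding agree_def by (meson not_less)
  \<comment> \<open>Any pair parting exactly at place i is the image of (x, y) under
    \<open>Aut\<close>: move x' to x, then use the stabiliser of x.\<close>
  have R1: "R x' y'" if p: "x' \<in> bdry d k" "y' \<in> bdry d k" "agree i x' y'" "x' i \<noteq> y' i" for x' y'
  proof -
    obtain a where a: "a \<in> Aut d k" "a x' = x" using Aut_transitive[OF p(1) xy(1)] by blast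
    have ab: "bperm d k a" "\<And>n. pres d k n a" using a(1) by (auto simp: Aut_iff)
    have ay: "a y' \<in> bdry d k" using ab p bperm_in by blast
    have "agree i x (a y')" using ab(2) p a(2) presD by metis
    moreover have "\<not> agree (Suc i) x' y'" using p(4) unfolding agree_def by blast
    then have "\<not> agree (Suc i) x (a y')" using ab(2) p a(2) presD by metis
    ultimately have ai: "agree i x (a y')" "x i \<noteq> a y' i" by (auto simp: agree_def less_Suc_eq)
    obtain b where b: "b \<in> Aut d k" "b x = x" "b y = a y'"
      using Aut_transitive_sphere[OF xy(1,2) ay xy(4,5) ai] by blast
    have "R x (a y')" using R_H[OF xy(3), of b] b Aut_sub by auto
    then have "R (inv_into UNIV a x) (inv_into UNIV a (a y'))"
      using R_H Aut_inv[OF a(1)] Aut_sub by blast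
    moreover have "inj a" using ab bperm_bij bij_is_inj by blast
    ultimately show ?thesis using a(2) by (metis inv_f_f)
  qed
  have R_iff: "R x' y' \<longleftrightarrow> agree i x' y'" if x': "x' \<in> bdry d k" and y': "y' \<in> bdry d k" for x' y'
  proof
    assume R: "R x' y'"
    show "agree i x' y'"
    proof (cases "x' = y'")
      case False
      let ?j = "LEAST i. x' i \<noteq> y' i"
      have "agree ?j x' y'" using agree_iff_le_Least[OF False] by blast
      moreover have "x' ?j \<noteq> y' ?j" using False by (intro LeastI_ex[of "\<lambda>i. x' i \<noteq> y' i"]) auto
      ultimately have "i \<le> ?j" unfolding i_def using R x' y' by (intro Least_le) blast
      then show ?thesis using agree_iff_le_Least[OF False] by blast
    qed simp
  next
    assume ag: "agree i x' y'"
    show "R x' y'"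
    proof (cases "x' i = y' i")
      case True
      \<comment> \<open>Neither ray parts from the other at place i, but both part there from z, so
        they are related through z.\<close>
      obtain z where z: "z \<in> bdry d k" "agree i x' z" "x' i \<noteq> z i" using change_coord[OF x'] by metis
      have "R x' z" using R1 x' z by blast
      moreover have "R y' z" using R1[OF y' z(1)] z ag True agree_trans agree_sym by metis
      ultimately show ?thesis unfolding R_def by blast
    qed (use R1 x' y' ag in blast)
  qed
  have "pres d k i h" if h: "h \<in> H" for h
  proof (rule pres_if_agree_imp[OF H_bperm[OF h]])
    fix x y assume xy: "x \<in> bdry d k" "y \<in> bdry d k" "agree i x y"
    then have "R (h x) (h y)" using R_iff R_H h by blast
    then show "agree i (h x) (h y)" using R_iff bperm_in[OF H_bperm[OF h]] xy by blast
  qed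
  moreover have "i \<ge> N" using \<open>n \<le> i\<close> by (simp add: n_def)
  ultimately show ?thesis using that by blast
qed

text \<open>Conjugating by swaps moves a violation of level j to level j + 1; together with the unbounded
  set of preserved levels this excludes violations from some level on.\<close>
lemma uniformly_pres:
  obtains M where "\<And>n h. n \<ge> M \<Longrightarrow> h \<in> H \<Longrightarrow> pres d k n h"
proof -
  \<comment> \<open>One swap for each child i of the root, with a second child as partner, so that
    every ray lies in the ball of level 1 of some \<open>c i\<close>.\<close>
  define c :: "nat \<Rightarrow> ray" where "c i = (\<lambda>j. if j = 0 then i else 0)" for i
  define e :: "nat \<Rightarrow> ray" where "e i = c (if i = 0 then 1 else 0)" for i
  have c: "c i \<in> bdry d k" if "i < k" for i using that d2 by (auto simp: c_def bdry_def)
  have e: "e i \<in> bdry d k" "c i 0 \<noteq> e i 0" if "i < k" for i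
    using that d2 k2 by (auto simp: c_def e_def bdry_def)
  obtain F where F: "finite F" "F \<subseteq> H"
    "\<And>h. h \<in> H \<Longrightarrow> \<exists>f\<in>F. \<forall>i\<in>{..<k}. \<exists>l\<in>swap_stab 1 (c i) (e i). h = l \<circ> f"
    using swap_stab_reps[of "{..<k}" "\<lambda>_. 1" c e] c e by auto
  obtain M0 where M0: "\<And>f n. f \<in> F \<Longrightarrow> n \<ge> M0 \<Longrightarrow> pres d k n f"
    using eventually_pres_finite[OF F(1,2)] by blast
  \<comment> \<open>From \<open>M0\<close> on, elements of F respect levels; level at least 1 puts f
    x and f y below the same child of the root.\<close>
  define M where "M = max 1 M0"
  have step: "\<exists>h'\<in>H. \<not> pres d k (Suc j) h'" if j: "j \<ge> M" and h: "h \<in> H" "\<not> pres d k j h" for j h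
  proof -
    obtain x y where xy: "x \<in> bdry d k" "y \<in> bdry d k" "agree j x y" "\<not> agree j (h x) (h y)"
      using h pres_if_agree_imp[OF H_bperm[OF h(1)]] by blast
    obtain f where f: "f \<in> F" "\<forall>i\<in>{..<k}. \<exists>l\<in>swap_stab 1 (c i) (e i). h = l \<circ> f"
      using F(3)[OF h(1)] by blast
    have fxy: "f x \<in> bdry d k" "f y \<in> bdry d k" using f(1) F(2) xy H_bperm bperm_in by blast+
    have fa: "agree j (f x) (f y)" using M0[OF f(1), of j] j xy by (simp add: M_def pres_def)
    define i where "i = f x 0"
    have i: "i < k" using fxy by (simp add: i_def bdry_def)
    let ?g = "ball_swap 1 (c i) (e i)"
    note cei = le_refl[of "1::nat"] c[OF i] e[OF i]
    obtain l where l: "l \<in> swap_stab 1 (c i) (e i)" "h = l \<circ> f" using f(2) i by blast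
    obtain h' N where h': "h' \<in> H" "l = ?g \<circ> h' \<circ> ?g"
      "\<And>m. m \<ge> N \<Longrightarrow> pres d k m l" "\<And>m. m \<ge> N \<Longrightarrow> pres d k m h'"
      using swap_stab_local_isometry[OF l(1)] by blast
    have U: "agree 1 (c i) (f x)" "agree 1 (c i) (f y)"
      using fa j by (auto simp: agree_def c_def i_def M_def)
    note h'b = H_bperm[OF h'(1)]
    have V: "agree (Suc 1) (e i) (h' (?g (f x)))" "agree (Suc 1) (e i) (h' (?g (f y)))"
      using ball_swap_conj_upper(2)[OF cei h'(3,4) h'b h'(2)] fxy U by blast+
    have in1: "?g (f x) \<in> bdry d k" "?g (f y) \<in> bdry d k" using ball_swap_bdry[OF cei] fxy by blast+
    have in2: "h' (?g (f x)) \<in> bdry d k" "h' (?g (f y)) \<in> bdry d k"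
      using in1 bperm_in[OF h'b] by blast+
    \<comment> \<open>Both images lie in the ball of \<open>e i\<close>, where the outer swap loses
      exactly one level: disagreement at level j after it comes from disagreement at level j + 1
      before it.\<close>
    have "\<not> agree (Suc j) (h' (?g (f x))) (h' (?g (f y)))"
      using ball_swap_agree_lower[OF cei in2 V, of j] xy(4) unfolding l(2) h'(2) by simp
    moreover have "agree (Suc j) (?g (f x)) (?g (f y))"
      using ball_swap_agree_upper[OF cei fxy U, of j] fa by simp
    ultimately show ?thesis using h'(1) in1 presD by blast
  qed
  show ?thesis
  proof (rule that[of M], rule ccontr)
    fix n h assume n: "n \<ge> M" and h: "h \<in> H" and np: "\<not> pres d k n h"
    have viol: "\<exists>h'\<in>H. \<not> pres d k (n + j) h'" for j
      by (induction j) (use h np step n in \<open>auto simp: trans_le_add1\<close>)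
    obtain i where "i \<ge> n" "\<And>h. h \<in> H \<Longrightarrow> pres d k i h" using preserved_level by blast
    then show False using viol[of "i - n"] by auto
  qed
qed

section \<open>Compactness from a uniform level bound\<close>

lemma level_stab_iff: "u \<in> level_stab d k n \<longleftrightarrow> u \<in> Aut d k \<and> (\<forall>x\<in>bdry d k. agree n (u x) x)"
  unfolding level_stab_def agree_def by blast

lemma level_stab_antimono: "m \<le> n \<Longrightarrow> level_stab d k n \<subseteq> level_stab d k m"
  unfolding subset_iff level_stab_iff using agree_mono by blast

lemma level_stab_comp:
  assumes u: "u \<in> level_stab d k n" and v: "v \<in> level_stab d k n"
  shows "u \<circ> v \<in> level_stab d k n"
  unfolding level_stab_iff
proof (intro conjI ballI)
  have Aut: "u \<in> Aut d k" "v \<in> Aut d k" using u v unfolding level_stab_iff by blast+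
  then show "u \<circ> v \<in> Aut d k" by (rule Aut_comp)
  fix x assume x: "x \<in> bdry d k"
  have "v x \<in> bdry d k" using Aut(2) x bperm_in Aut_iff by blast
  then have "agree n (u (v x)) (v x)" "agree n (v x) x" using u v x unfolding level_stab_iff by blast+
  then show "agree n ((u \<circ> v) x) x" unfolding comp_apply by (rule agree_trans)
qed

text \<open>Level stabilisers are closed under composition, so a generating set g U containing h
  also contains h U; for finite intersections the larger level serves.\<close>

lemma openin_AAut_top_level_stab:
  assumes "openin (AAut_top d k) W" "h \<in> W"
  shows "\<exists>n. (\<circ>) h ` level_stab d k n \<subseteq> W"
proof -
  from assms(1) have "generate_topology_on {(\<lambda>u. g \<circ> u) ` level_stab d k n | g n. g \<in> AAut d k} W"
    unfolding AAut_top_def openin_topology_generated_by_iff .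
  then show ?thesis using assms(2)
  proof (induction rule: generate_topology_on.induct)
    case Empty
    then show ?case by simp
  next
    case (Int A B)
    obtain m where m: "(\<circ>) h ` level_stab d k m \<subseteq> A" using Int.IH(1) Int.prems by blast
    obtain n where n: "(\<circ>) h ` level_stab d k n \<subseteq> B" using Int.IH(2) Int.prems by blast
    have "(\<circ>) h ` level_stab d k (max m n) \<subseteq> A"
      using image_mono[OF level_stab_antimono[OF max.cobounded1]] m by (rule order_trans)
    moreover have "(\<circ>) h ` level_stab d k (max m n) \<subseteq> B"
      using image_mono[OF level_stab_antimono[OF max.cobounded2]] n by (rule order_trans)
    ultimately have "(\<circ>) h ` level_stab d k (max m n) \<subseteq> A \<inter> B" by (rule Int_greatest)
    then show ?case by (rule exI)
  next
    case (UN K)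
    then obtain A where A: "A \<in> K" "h \<in> A" by blast
    then obtain n where "(\<circ>) h ` level_stab d k n \<subseteq> A" using UN.IH by blast
    with A have "(\<circ>) h ` level_stab d k n \<subseteq> \<Union>K" by blast
    then show ?case by (rule exI)
  next
    case (Basis S)
    then obtain g n where g: "S = (\<circ>) g ` level_stab d k n" by blast
    with Basis obtain u where u: "u \<in> level_stab d k n" "h = g \<circ> u" by blast
    have "h \<circ> v \<in> S" if "v \<in> level_stab d k n" for v
    proof -
      have "g \<circ> (u \<circ> v) \<in> S" unfolding g using level_stab_comp[OF u(1) that] by (rule imageI)
      then show ?thesis by (simp add: u(2) comp_assoc)
    qed
    then have "(\<circ>) h ` level_stab d k n \<subseteq> S" by blast
    then show ?case by (rule exI)
  qed
qed

definition close :: "nat \<Rightarrow> amap \<Rightarrow> amap \<Rightarrow> bool" where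
  "close n g h \<longleftrightarrow> (\<forall>x\<in>bdry d k. agree n (g x) (h x))"

text \<open>An element respecting level n is determined up to \<open>close n\<close> by the self-map
  it induces on the finite set of words.\<close>

lemma close_finite_cells:
  assumes "\<And>h. h \<in> H \<Longrightarrow> pres d k n h"
  obtains F where "finite F" "F \<subseteq> H" "\<And>h. h \<in> H \<Longrightarrow> \<exists>f\<in>F. close n f h"
proof -
  define \<kappa> where "\<kappa> h = (\<lambda>x\<in>words d k n. trunc n (h x))" for h :: amap
  have "\<kappa> ` H \<subseteq> words d k n \<rightarrow>\<^sub>E words d k n"
    using trunc_in_words H_bperm bperm_in words_sub by (auto simp: \<kappa>_def)
  then have "finite (\<kappa> ` H)" by (rule finite_subset) (auto intro: finite_PiE simp: finite_words)
  then obtain F where F: "F \<subseteq> H" "finite F" "\<kappa> ` H = \<kappa> ` F"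
    using finite_subset_image[of "\<kappa> ` H" \<kappa> H] by blast
  show ?thesis
  proof (rule that[OF F(2,1)])
    fix h assume h: "h \<in> H"
    then obtain f where f: "f \<in> F" "\<kappa> h = \<kappa> f" using F(3) by blast
    have "agree n (f x) (h x)" if x: "x \<in> bdry d k" for x
    proof -
      let ?t = "trunc n x"
      have t: "?t \<in> words d k n" "?t \<in> bdry d k" using trunc_in_words words_sub x by blast+
      have "agree n (f ?t) (h ?t)"
        using fun_cong[OF f(2), of ?t] t(1) by (simp add: \<kappa>_def trunc_eq_iff agree_commute)
      moreover have "agree n (f x) (f ?t)" "agree n (h ?t) (h x)"
        using assms h f(1) F(1) x t(2) by (auto simp: pres_def)
      ultimately show ?thesis using agree_trans by blast
    qed
    then show "\<exists>f\<in>F. close n f h" using f(1) by (auto simp: close_def)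
  qed
qed

text \<open>The quotient u of h by g moves no ball of level n. Levels from M on are respected by g
  and h; a level below M is respected since u moves nothing there.\<close>

lemma close_level_stab:
  assumes M: "\<And>m. m \<ge> M \<Longrightarrow> pres d k m g" "\<And>m. m \<ge> M \<Longrightarrow> pres d k m h"
    and gh: "bperm d k g" "bperm d k h" and n: "n \<ge> M" "close n g h"
  shows "h \<in> (\<circ>) g ` level_stab d k n"
proof -
  define u where "u = inv_into UNIV g \<circ> h"
  note bg = bperm_bij[OF gh(1)]
  have gu: "g (u x) = h x" for x using bg by (simp add: u_def bij_is_surj surj_f_inv_f)
  have ub: "bperm d k u" unfolding u_def by (intro bperm_comp bperm_inv gh)
  have un: "agree n (u x) x" if x: "x \<in> bdry d k" for x
  proof -
    have "agree n (g (u x)) (g x)" using n(2) x gu agree_sym by (auto simp: close_def)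
    then show ?thesis using M(1)[OF n(1)] x bperm_in[OF ub x] presD by blast
  qed
  have "pres d k m u" for m
  proof (cases "m \<ge> M")
    case True
    then show ?thesis unfolding u_def by (intro pres_comp pres_inv M gh)
  next
    case False
    then have "agree m (u x) x" if "x \<in> bdry d k" for x using un[OF that] n(1) agree_mono by force
    then show ?thesis unfolding pres_def by (meson agree_sym agree_trans)
  qed
  then have "u \<in> level_stab d k n" using ub un unfolding level_stab_iff Aut_iff by blast
  moreover have "h = g \<circ> u" using gu by auto
  ultimately show ?thesis by blast
qed

text \<open>Completeness of \<open>H\<close>: the pointwise limit is a permutation respecting all
  levels from M on, so it lies in the coset of \<open>Aut\<close> through \<open>s 0\<close>, which
  is contained in \<open>H\<close>.\<close>

lemma close_limit:
  assumes M: "\<And>n h. n \<ge> M \<Longrightarrow> h \<in> H \<Longrightarrow> pres d k n h"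
    and s: "\<And>n. s n \<in> H" "\<And>n. close (M + n) (s n) (s (Suc n))"
  obtains h where "h \<in> H" "\<And>n. close (M + n) (s n) h"
proof -
  have "\<exists>z. (\<forall>n. agree (M + n) (s n x) z) \<and> (\<forall>i. z i = s (Suc i) x i)" if "x \<in> bdry d k" for x
    using limit_of_agreeing_sequence[of M "\<lambda>n. s n x"] s(2) that unfolding close_def by metis
  then obtain h0 where h0: "\<And>x n. x \<in> bdry d k \<Longrightarrow> agree (M + n) (s n x) (h0 x)"
    "\<And>x i. x \<in> bdry d k \<Longrightarrow> h0 x i = s (Suc i) x i" by metis
  define h where "h x = (if x \<in> bdry d k then h0 x else x)" for x
  have close_h: "close (M + n) (s n) h" for n using h0(1) by (simp add: close_def h_def)
  have sb: "bperm d k (s n)" for n using H_bperm s(1) by blast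
  have in_h: "h x \<in> bdry d k" if x: "x \<in> bdry d k" for x
  proof -
    have "s (Suc i) x \<in> bdry d k" for i using bperm_in[OF sb x] .
    then show ?thesis using h0(2)[OF x] x by (auto simp: h_def bdry_def)
  qed
  have pres_h: "pres d k (M + n) h" for n
    unfolding pres_def
  proof (intro ballI)
    fix x y assume xy: "x \<in> bdry d k" "y \<in> bdry d k"
    have "agree (M + n) (s n x) (s n y) \<longleftrightarrow> agree (M + n) x y"
      using M[OF _ s(1), of "M + n" n] xy by (simp add: pres_def)
    moreover have "agree (M + n) (s n x) (h x)" "agree (M + n) (s n y) (h y)"
      using close_h xy by (auto simp: close_def)
    ultimately show "agree (M + n) (h x) (h y) \<longleftrightarrow> agree (M + n) x y"
      by (meson agree_sym agree_trans)
  qed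
  have "inj_on h (bdry d k)"
  proof (rule inj_onI)
    fix x y assume xy: "x \<in> bdry d k" "y \<in> bdry d k" "h x = h y"
    have "agree (M + n) x y" for n using presD[OF pres_h xy(1,2)] xy(3) by simp
    then show "x = y" by (intro agree_all_eq) (meson agree_mono le_add2)
  qed
  moreover have "bdry d k \<subseteq> h ` bdry d k"
  proof
    fix y assume y: "y \<in> bdry d k"
    \<comment> \<open>The preimages of y under the \<open>s n\<close> again agree on growing
      prefixes, because \<open>s n\<close> respects level M + n; their limit is a preimage under
      h.\<close>
    define t where "t n = inv_into UNIV (s n) y" for n
    have t: "t n \<in> bdry d k" "s n (t n) = y" for n
      using bperm_in[OF bperm_inv[OF sb] y] bperm_bij[OF sb]
      by (auto simp: t_def bij_is_surj surj_f_inv_f)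
    have "agree (M + n) (t n) (t (Suc n))" for n
    proof -
      have "agree (M + n) (s n (t (Suc n))) (s (Suc n) (t (Suc n)))"
        using s(2) t(1) by (auto simp: close_def)
      then have "agree (M + n) (s n (t n)) (s n (t (Suc n)))" using t(2) agree_sym by metis
      then show ?thesis using M[OF _ s(1), of "M + n" n] t(1) by (simp add: pres_def)
    qed
    then obtain x where x: "\<And>n. agree (M + n) (t n) x" "\<And>i. x i = t (Suc i) i"
      using limit_of_agreeing_sequence by blast
    have xb: "x \<in> bdry d k" using t(1) x(2) by (auto simp: bdry_def)
    have "agree (M + n) (h x) y" for n
    proof -
      have "agree (M + n) (s n (t n)) (s n x)"
        using M[OF _ s(1), of "M + n" n] t(1) xb x(1) by (simp add: pres_def)
      moreover have "agree (M + n) (s n x) (h x)" using close_h xb by (auto simp: close_def)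
      ultimately show ?thesis using t(2) by (metis agree_sym agree_trans)
    qed
    then have "h x = y" by (intro agree_all_eq) (meson agree_mono le_add2)
    then show "y \<in> h ` bdry d k" using xb by blast
  qed
  ultimately have hb: "bperm d k h" using in_h by (auto simp: bperm_def bij_betw_def h_def)
  have "h \<in> (\<circ>) (s 0) ` level_stab d k (M + 0)"
  proof (rule close_level_stab)
    show "pres d k m h" if "m \<ge> M" for m using pres_h[of "m - M"] that by simp
    show "close (M + 0) (s 0) h" by (rule close_h)
  qed (use M s(1) sb hb in auto)
  then obtain u where "u \<in> Aut d k" "h = s 0 \<circ> u" unfolding level_stab_def by blast
  then have "h \<in> H" using s(1) Aut_sub H_comp by blast
  then show ?thesis using that close_h by blast
qed

text \<open>Total boundedness and completeness: each level has finitely many cells, so if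
  \<open>H\<close> had no finite subcover, cells without one could be chosen at all levels and would
  shrink to a point of \<open>H\<close>.\<close>

lemma compactin_H: "compactin (AAut_top d k) H"
  unfolding compactin_def
proof (intro conjI allI impI)
  show "H \<subseteq> topspace (AAut_top d k)" using H_AAut AAut_sub_topspace by blast
  fix \<U> assume \<U>: "Ball \<U> (openin (AAut_top d k)) \<and> H \<subseteq> \<Union>\<U>"
  obtain M where M: "\<And>n h. n \<ge> M \<Longrightarrow> h \<in> H \<Longrightarrow> pres d k n h" using uniformly_pres by blast
  define small where "small A \<longleftrightarrow> (\<exists>\<F>. finite \<F> \<and> \<F> \<subseteq> \<U> \<and> A \<subseteq> \<Union>\<F>)" for A
  define cell where "cell n h = {h' \<in> H. close n h h'}" for n h
  have split: "\<exists>h\<in>H. \<not> small (A \<inter> cell n h)" if A: "A \<subseteq> H" "\<not> small A" and n: "n \<ge> M" for A n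
  proof (rule ccontr)
    assume "\<not> ?thesis"
    then have "\<forall>h\<in>H. \<exists>\<F>. finite \<F> \<and> \<F> \<subseteq> \<U> \<and> A \<inter> cell n h \<subseteq> \<Union>\<F>" unfolding small_def by blast
    then obtain \<F> where \<F>: "\<And>h. h \<in> H \<Longrightarrow> finite (\<F> h) \<and> \<F> h \<subseteq> \<U> \<and> A \<inter> cell n h \<subseteq> \<Union>(\<F> h)"
      by metis
    obtain F where F: "finite F" "F \<subseteq> H" "\<And>h. h \<in> H \<Longrightarrow> \<exists>f\<in>F. close n f h"
      using close_finite_cells[OF M[OF n]] by blast
    have "A \<subseteq> \<Union>(\<Union>f\<in>F. \<F> f)"
    proof
      fix h assume "h \<in> A"
      then obtain f where f: "f \<in> F" "h \<in> A \<inter> cell n f" using F(3) A(1) by (auto simp: cell_def)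
      have "A \<inter> cell n f \<subseteq> \<Union>(\<F> f)" using \<F>[of f] f(1) F(2) by auto
      with f(2) have "h \<in> \<Union>(\<F> f)" by (rule subsetD[rotated])
      with f(1) show "h \<in> \<Union>(\<Union>f\<in>F. \<F> f)" by auto
    qed
    moreover have "finite (\<F> f)" "\<F> f \<subseteq> \<U>" if "f \<in> F" for f
      using \<F>[of f] that F(2) by auto
    then have "finite (\<Union>f\<in>F. \<F> f)" "(\<Union>f\<in>F. \<F> f) \<subseteq> \<U>" using F(1) by auto
    ultimately have "small A" unfolding small_def by (intro exI[of _ "\<Union>f\<in>F. \<F> f"] conjI)
    with A show False by simp
  qed
  have small_mono: "small A" if "small B" "A \<subseteq> B" for A B using that unfolding small_def by blast
  show "\<exists>\<F>. finite \<F> \<and> \<F> \<subseteq> \<U> \<and> H \<subseteq> \<Union>\<F>"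
  proof (rule ccontr)
    assume "\<not> ?thesis"
    then have bad: "\<not> small H" by (simp add: small_def)
    have "\<exists>s. \<forall>n. (s n \<in> H \<and> \<not> small (cell (M + n) (s n))) \<and> close (M + n) (s n) (s (Suc n))"
    proof (rule dependent_nat_choice)
      show "\<exists>h. h \<in> H \<and> \<not> small (cell (M + 0) h)"
        using split[OF subset_refl bad, of M] small_mono by (metis add_0_right inf_le2 order_refl)
      fix h n assume h: "h \<in> H \<and> \<not> small (cell (M + n) h)"
      then obtain g where g: "g \<in> H" "\<not> small (cell (M + n) h \<inter> cell (M + Suc n) g)"
        using split[of "cell (M + n) h" "M + Suc n"] by (auto simp: cell_def)
      \<comment> \<open>The empty set is small, so the intersection has an element f; through f the
        two centres are close at level M + n.\<close>
      then have "cell (M + n) h \<inter> cell (M + Suc n) g \<noteq> {}"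
        unfolding small_def by (metis empty_subsetI finite.emptyI)
      then obtain f where f: "close (M + n) h f" "close (M + Suc n) g f" by (auto simp: cell_def)
      have "close (M + n) h g"
        unfolding close_def
      proof
        fix x assume "x \<in> bdry d k"
        then have "agree (M + n) (h x) (f x)" "agree (M + Suc n) (g x) (f x)"
          using f by (auto simp: close_def)
        moreover from this(2) have "agree (M + n) (g x) (f x)" by (rule agree_mono) simp
        ultimately show "agree (M + n) (h x) (g x)" by (meson agree_sym agree_trans)
      qed
      moreover have "\<not> small (cell (M + Suc n) g)" using g(2) small_mono by blast
      ultimately show "\<exists>g. (g \<in> H \<and> \<not> small (cell (M + Suc n) g)) \<and> close (M + n) h g"
        using g(1) by blast
    qed
    then obtain s where s: "\<And>n. s n \<in> H" "\<And>n. \<not> small (cell (M + n) (s n))"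
      "\<And>n. close (M + n) (s n) (s (Suc n))" by blast
    obtain h where h: "h \<in> H" "\<And>n. close (M + n) (s n) h" using close_limit[OF M s(1,3)] by blast
    obtain W where W: "W \<in> \<U>" "h \<in> W" using h(1) \<U> by blast
    have "openin (AAut_top d k) W" using \<U> W(1) by blast
    from openin_AAut_top_level_stab[OF this W(2)]
    obtain n where n: "(\<circ>) h ` level_stab d k n \<subseteq> W" by (rule exE)
    \<comment> \<open>Once the level is large enough, one member of the cover contains the whole
      cell, contradicting its choice.\<close>
    have "cell (M + n) (s n) \<subseteq> W"
    proof
      fix g assume g: "g \<in> cell (M + n) (s n)"
      then have gH: "g \<in> H" by (simp add: cell_def)
      have "close (M + n) h g"
        using g h(2)[of n] unfolding cell_def close_def
        by (metis (mono_tags, lifting) agree_sym agree_trans mem_Collect_eq)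
      then have "g \<in> (\<circ>) h ` level_stab d k (M + n)"
        using M h(1) gH H_bperm by (intro close_level_stab[of M]) auto
      moreover have "level_stab d k (M + n) \<subseteq> level_stab d k n" by (simp add: level_stab_antimono)
      ultimately show "g \<in> W" using n by blast
    qed
    then have "small (cell (M + n) (s n))" unfolding small_def using W(1) by (intro exI[of _ "{W}"]) auto
    with s(2) show False by blast
  qed
qed

end

theorem mainTheorem14:
  fixes d k :: nat and H :: "amap set"
  assumes "d \<ge> 2" and "k \<ge> 2"
    and "subgroup H (AAutG d k)"
    and "locally_elliptic (AAutG d k) (AAut_top d k) H"
    and "commensurated (AAutG d k) H"
    and "Aut d k \<subseteq> H"
  shows "compactin (AAut_top d k) H"
proof -
  interpret commensurated_overgroup d k H
  proof (rule commensurated_overgroup.intro)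
    show "elliptic_overgroup d k H"
      by (rule elliptic_overgroup.intro[OF tree_boundary.intro[OF assms(1,2)]
        elliptic_overgroup_axioms.intro[OF assms(3,4,6)]])
    show "commensurated_overgroup_axioms d k H"
      by (rule commensurated_overgroup_axioms.intro[OF assms(5)])
  qed
  show ?thesis by (rule compactin_H)
qed

end
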